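(* If $\mathrm{ULST}(\mathcal L(I))$ exists, then there is a pair of cardinals $\kappa\le\gamma$ such that $\kappa$ is cardinal correct extendible pushing up $\gamma$.
   Context: $\mathcal L(I)$ is first-order logic augmented with the Härtig (equicardinality) quantifier: $Ixy\,\varphi(x)\psi(y)$ holds iff the sets defined by $\varphi$ and $\psi$ have the same cardinality. A transitive model $M$ is cardinal correct if every $\gamma$ that $M$ believes to be a cardinal is a cardinal in $V$. For $\kappa\le\gamma$, $\kappa$ is cardinal correct extendible pushing up $\gamma$ if for every $\alpha>\gamma$ there is an elementary embedding $j:V_\alpha\to M$ with $M$ transitive and cardinal correct, critical point $\kappa$, and $j(\gamma)>\alpha$. $\mathrm{ULST}(\mathcal L)$ is the least cardinal $\delta$ such that for every language $\tau$, every $\mathcal L(\tau)$-sentence $\varphi$, every $\tau$-structure $M\models_{\mathcal L}\varphi$ with $|M|=\gamma\ge\delta$ and every cardinal $\bar\gamma>\gamma$, there is a $\tau$-structure $\bar M\models_{\mathcal L}\varphi$ of size $\ge\bar\gamma$ with $M$ a substructure of $\bar M$. *)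

theory Defs
  imports "HOL-Library.Equipollence"
begin

section \<open>The universe of sets\<close>

text \<open>
  The sort \<open>zfc\<close> plays the role of the universe \<open>V\<close> of the ambient theory ZFC. Classes are
  HOL predicates and HOL functions on the type, and Separation and Replacement are stated for
  all of them. A theorem about \<open>'v::zfc\<close> is thus a theorem about an arbitrary such universe.
  Separation, Pairing and (by Hilbert choice) Choice are redundant; they are listed to have all
  the usual axioms.
\<close>

class zfc =
  fixes mem :: "'a \<Rightarrow> 'a \<Rightarrow> bool"  (infix "\<^bold>\<in>" 50)
  assumes Extensionality: "(\<And>z. z \<^bold>\<in> x \<longleftrightarrow> z \<^bold>\<in> y) \<Longrightarrow> x = y"
    and Foundation: "(\<exists>z. z \<^bold>\<in> x) \<Longrightarrow> \<exists>z. z \<^bold>\<in> x \<and> \<not> (\<exists>w. w \<^bold>\<in> x \<and> w \<^bold>\<in> z)"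
    and Pairing: "\<exists>p. \<forall>z. z \<^bold>\<in> p \<longleftrightarrow> z = x \<or> z = y"
    and Union: "\<exists>u. \<forall>z. z \<^bold>\<in> u \<longleftrightarrow> (\<exists>y. y \<^bold>\<in> x \<and> z \<^bold>\<in> y)"
    and Power: "\<exists>p. \<forall>z. z \<^bold>\<in> p \<longleftrightarrow> (\<forall>w. w \<^bold>\<in> z \<longrightarrow> w \<^bold>\<in> x)"
    and Infinity: "\<exists>x. (\<exists>e. e \<^bold>\<in> x \<and> (\<forall>z. \<not> z \<^bold>\<in> e)) \<and>
           (\<forall>y. y \<^bold>\<in> x \<longrightarrow> (\<exists>s. s \<^bold>\<in> x \<and> (\<forall>z. z \<^bold>\<in> s \<longleftrightarrow> z \<^bold>\<in> y \<or> z = y)))"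
    and Separation: "\<exists>y. \<forall>z. z \<^bold>\<in> y \<longleftrightarrow> z \<^bold>\<in> x \<and> P z"
    and Replacement: "\<exists>y. \<forall>z. z \<^bold>\<in> y \<longleftrightarrow> (\<exists>w. w \<^bold>\<in> x \<and> z = F w)"
    and Choice: "\<lbrakk>\<And>y. y \<^bold>\<in> x \<Longrightarrow> \<exists>z. z \<^bold>\<in> y;
           \<And>y y'. \<lbrakk>y \<^bold>\<in> x; y' \<^bold>\<in> x; y \<noteq> y'\<rbrakk> \<Longrightarrow> \<not> (\<exists>z. z \<^bold>\<in> y \<and> z \<^bold>\<in> y')\<rbrakk>
         \<Longrightarrow> \<exists>c. \<forall>y. y \<^bold>\<in> x \<longrightarrow> (\<exists>!z. z \<^bold>\<in> y \<and> z \<^bold>\<in> c)"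

definition elts :: "'v::zfc \<Rightarrow> 'v set" where
  "elts x = {y. y \<^bold>\<in> x}"

text \<open>A HOL set over the universe is a class; the small ones are the sets of the universe.\<close>

definition small :: "'v::zfc set \<Rightarrow> bool" where
  "small X \<longleftrightarrow> (\<exists>x. X = elts x)"

definition transitive_class :: "'v::zfc set \<Rightarrow> bool" where
  "transitive_class M \<longleftrightarrow> (\<forall>x\<in>M. elts x \<subseteq> M)"


section \<open>Ordinals, cardinals and the cumulative hierarchy\<close>

definition Ord :: "'v::zfc \<Rightarrow> bool" where
  "Ord \<alpha> \<longleftrightarrow> transitive_class (elts \<alpha>) \<and> (\<forall>\<beta>\<in>elts \<alpha>. transitive_class (elts \<beta>))"

definition ord_le :: "'v::zfc \<Rightarrow> 'v \<Rightarrow> bool"  (infix "\<^bold>\<le>" 50) where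
  "\<alpha> \<^bold>\<le> \<beta> \<longleftrightarrow> \<alpha> \<^bold>\<in> \<beta> \<or> \<alpha> = \<beta>"

text \<open>By Replacement, a HOL bijection between sets of the universe is itself a set of it.\<close>

definition Card :: "'v::zfc \<Rightarrow> bool" where
  "Card \<gamma> \<longleftrightarrow> Ord \<gamma> \<and> (\<forall>\<beta>\<in>elts \<gamma>. \<not> elts \<beta> \<approx> elts \<gamma>)"

lemma wf_mem: "wf {(y, x). y \<^bold>\<in> (x::'v::zfc)}"
proof (rule wfI_min)
  fix x :: 'v and Q assume "x \<in> Q"
  obtain step :: "'v \<Rightarrow> 'v" where step: "\<And>x z. z \<^bold>\<in> step x \<longleftrightarrow> (\<exists>y. y \<^bold>\<in> x \<and> z \<^bold>\<in> y)"
    using Union by metis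
  obtain I e where I: "e \<^bold>\<in> I" "\<forall>z. \<not> z \<^bold>\<in> (e::'v)"
      "\<forall>y. y \<^bold>\<in> I \<longrightarrow> (\<exists>s. s \<^bold>\<in> I \<and> (\<forall>z. z \<^bold>\<in> s \<longleftrightarrow> z \<^bold>\<in> y \<or> z = y))"
    using Infinity by metis
  obtain sc where sc: "\<And>y. y \<^bold>\<in> I \<Longrightarrow> sc y \<^bold>\<in> I \<and> (\<forall>z. z \<^bold>\<in> sc y \<longleftrightarrow> z \<^bold>\<in> y \<or> z = y)"
    using I(3) by metis
  define nn where "nn = (\<lambda>n. (sc ^^ n) e)"
  have nnI: "nn n \<^bold>\<in> I" for n
    by (induction n) (auto simp: nn_def I sc)
  have nn_Suc: "z \<^bold>\<in> nn (Suc n) \<longleftrightarrow> z \<^bold>\<in> nn n \<or> z = nn n" for z n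
    using sc[OF nnI[of n]] by (simp add: nn_def)
  have nn_less: "m < n \<Longrightarrow> nn m \<^bold>\<in> nn n" for m n
    by (induction n) (auto simp: nn_Suc less_Suc_eq)
  have irrefl: "\<not> y \<^bold>\<in> (y::'v)" for y
    using Pairing[of y y] Foundation by metis
  have inj: "inj nn"
    by (rule injI) (metis irrefl nn_less nat_neq_iff)
  define lev where "lev = (\<lambda>i. (step ^^ the_inv nn i) x)"
  have lev: "lev (nn n) = (step ^^ n) x" for n
    by (simp add: lev_def the_inv_f_f inj)
  obtain R where R: "\<And>z. z \<^bold>\<in> R \<longleftrightarrow> (\<exists>w. w \<^bold>\<in> I \<and> z = lev w)"
    using Replacement[of I lev] by blast
  obtain U where U: "\<And>z. z \<^bold>\<in> U \<longleftrightarrow> (\<exists>y. y \<^bold>\<in> R \<and> z \<^bold>\<in> y)"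
    using Union[of R] by blast
  obtain S where S: "\<And>z. z \<^bold>\<in> S \<longleftrightarrow> z \<^bold>\<in> U \<and> z \<in> Q \<and> (\<exists>n. z \<^bold>\<in> (step ^^ n) x)"
    using Separation[of U "\<lambda>z. z \<in> Q \<and> (\<exists>n. z \<^bold>\<in> (step ^^ n) x)"] by blast
  have S': "z \<^bold>\<in> S \<longleftrightarrow> z \<in> Q \<and> (\<exists>n. z \<^bold>\<in> (step ^^ n) x)" for z
    unfolding S U R by (metis lev nnI)
  show "\<exists>z\<in>Q. \<forall>y. (y, z) \<in> {(y, x). y \<^bold>\<in> x} \<longrightarrow> y \<notin> Q"
  proof (cases "\<exists>z. z \<^bold>\<in> S")
    case True
    then obtain z where z: "z \<^bold>\<in> S" "\<not> (\<exists>w. w \<^bold>\<in> S \<and> w \<^bold>\<in> z)"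
      using Foundation by blast
    obtain n where n: "z \<^bold>\<in> (step ^^ n) x" using z(1) S' by blast
    have "y \<notin> Q" if "y \<^bold>\<in> z" for y
    proof
      assume "y \<in> Q"
      moreover have "y \<^bold>\<in> (step ^^ Suc n) x" using n that step by auto
      ultimately show False using z(2) that S' by blast
    qed
    then show ?thesis using z(1) S' by auto
  next
    case False
    have "y \<notin> Q" if "y \<^bold>\<in> x" for y
    proof
      assume "y \<in> Q"
      moreover have "y \<^bold>\<in> (step ^^ 0) x" using that by simp
      ultimately show False using False S' by blast
    qed
    then show ?thesis using \<open>x \<in> Q\<close> by auto
  qed
qed

function V_stage :: "'v::zfc \<Rightarrow> 'v set" where
  "V_stage \<alpha> = (\<Union>\<beta>\<in>elts \<alpha>. {x. elts x \<subseteq> V_stage \<beta>})"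
  by auto
termination
  by (relation "{(y, x). y \<^bold>\<in> (x::'v::zfc)}") (auto simp: wf_mem elts_def)

declare V_stage.simps [simp del]


section \<open>Cardinals in the sense of a transitive model\<close>

text \<open>
  The following are first-order formulas of set theory, relativised to \<open>M\<close>: all quantifiers
  range over \<open>M\<close>. Functions are coded with the Quine-Rosser (flat) ordered pair
  \<open>{s``x | x \<in> a} \<union> {s``x \<union> {0} | x \<in> b}\<close>, where \<open>s n = n + 1\<close> for natural numbers \<open>n\<close> and
  \<open>s z = z\<close> otherwise. With Kuratowski pairs, \<open>V\<^sub>\<lambda>\<^sub>+\<^sub>2\<close> would contain no function onto \<open>\<lambda> + 1\<close>, for
  mere lack of pairs, and so believe \<open>\<lambda> + 1\<close> to be a cardinal. Flat pairs avoid this artefact: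
  for \<open>\<alpha> > \<omega>\<close>, any bijection between infinite ordinals below \<open>\<alpha>\<close> is coded in \<open>V\<^sub>\<alpha>\<close>.
\<close>

definition empty_in :: "'v::zfc set \<Rightarrow> 'v \<Rightarrow> bool" where
  "empty_in M x \<longleftrightarrow> \<not> (\<exists>z\<in>M. z \<^bold>\<in> x)"

definition succ_in :: "'v::zfc set \<Rightarrow> 'v \<Rightarrow> 'v \<Rightarrow> bool" where
  "succ_in M x y \<longleftrightarrow> (\<forall>z\<in>M. z \<^bold>\<in> y \<longleftrightarrow> z \<^bold>\<in> x \<or> z = x)"

definition trans_in :: "'v::zfc set \<Rightarrow> 'v \<Rightarrow> bool" where
  "trans_in M x \<longleftrightarrow> (\<forall>y\<in>M. \<forall>z\<in>M. y \<^bold>\<in> x \<and> z \<^bold>\<in> y \<longrightarrow> z \<^bold>\<in> x)"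

definition ord_in :: "'v::zfc set \<Rightarrow> 'v \<Rightarrow> bool" where
  "ord_in M x \<longleftrightarrow> trans_in M x \<and> (\<forall>y\<in>M. y \<^bold>\<in> x \<longrightarrow> trans_in M y)"

definition nat_in :: "'v::zfc set \<Rightarrow> 'v \<Rightarrow> bool" where
  "nat_in M n \<longleftrightarrow> ord_in M n \<and>
     (\<forall>m\<in>M. m = n \<or> m \<^bold>\<in> n \<longrightarrow> empty_in M m \<or> (\<exists>k\<in>M. succ_in M k m))"

definition shift_in :: "'v::zfc set \<Rightarrow> 'v \<Rightarrow> 'v \<Rightarrow> bool" where
  "shift_in M x y \<longleftrightarrow> (if nat_in M x then succ_in M x y else y = x)"

definition left_in :: "'v::zfc set \<Rightarrow> 'v \<Rightarrow> 'v \<Rightarrow> bool" where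
  "left_in M x u \<longleftrightarrow> (\<forall>y\<in>M. y \<^bold>\<in> u \<longleftrightarrow> (\<exists>z\<in>M. z \<^bold>\<in> x \<and> shift_in M z y))"

definition right_in :: "'v::zfc set \<Rightarrow> 'v \<Rightarrow> 'v \<Rightarrow> bool" where
  "right_in M x u \<longleftrightarrow>
     (\<forall>y\<in>M. y \<^bold>\<in> u \<longleftrightarrow> empty_in M y \<or> (\<exists>z\<in>M. z \<^bold>\<in> x \<and> shift_in M z y))"

definition pair_in :: "'v::zfc set \<Rightarrow> 'v \<Rightarrow> 'v \<Rightarrow> 'v \<Rightarrow> bool" where
  "pair_in M a b p \<longleftrightarrow> (\<forall>u\<in>M. u \<^bold>\<in> p \<longleftrightarrow>
     (\<exists>x\<in>M. x \<^bold>\<in> a \<and> left_in M x u) \<or> (\<exists>x\<in>M. x \<^bold>\<in> b \<and> right_in M x u))"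

definition app_in :: "'v::zfc set \<Rightarrow> 'v \<Rightarrow> 'v \<Rightarrow> 'v \<Rightarrow> bool" where
  "app_in M f x y \<longleftrightarrow> (\<exists>p\<in>M. p \<^bold>\<in> f \<and> pair_in M x y p)"

definition bij_in :: "'v::zfc set \<Rightarrow> 'v \<Rightarrow> 'v \<Rightarrow> 'v \<Rightarrow> bool" where
  "bij_in M f a b \<longleftrightarrow>
     (\<forall>p\<in>M. p \<^bold>\<in> f \<longrightarrow> (\<exists>x\<in>M. \<exists>y\<in>M. x \<^bold>\<in> a \<and> y \<^bold>\<in> b \<and> pair_in M x y p)) \<and>
     (\<forall>x\<in>M. x \<^bold>\<in> a \<longrightarrow> (\<exists>!y. y \<in> M \<and> y \<^bold>\<in> b \<and> app_in M f x y)) \<and>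
     (\<forall>y\<in>M. y \<^bold>\<in> b \<longrightarrow> (\<exists>!x. x \<in> M \<and> x \<^bold>\<in> a \<and> app_in M f x y))"

definition card_in :: "'v::zfc set \<Rightarrow> 'v \<Rightarrow> bool" where
  "card_in M \<gamma> \<longleftrightarrow> ord_in M \<gamma> \<and> \<not> (\<exists>\<beta>\<in>M. \<beta> \<^bold>\<in> \<gamma> \<and> (\<exists>f\<in>M. bij_in M f \<beta> \<gamma>))"

definition cardinal_correct :: "'v::zfc set \<Rightarrow> bool" where
  "cardinal_correct M \<longleftrightarrow> (\<forall>\<gamma>\<in>M. card_in M \<gamma> \<longrightarrow> Card \<gamma>)"


section \<open>The logic with the Haertig quantifier\<close>

record 's lang =
  Funs :: "'s set"
  Rels :: "'s set"
  fun_ar :: "'s \<Rightarrow> nat"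
  rel_ar :: "'s \<Rightarrow> nat"

datatype 's trm = Var nat | App 's "'s trm list"

datatype 's fm =
    Eq "'s trm" "'s trm"
  | Rel 's "'s trm list"
  | Neg "'s fm"
  | Conj "'s fm" "'s fm"
  | Ex nat "'s fm"
  | Hartig nat nat "'s fm" "'s fm"

primrec fv_trm :: "'s trm \<Rightarrow> nat set" where
  "fv_trm (Var n) = {n}"
| "fv_trm (App f ts) = \<Union> (set (map fv_trm ts))"

primrec fv :: "'s fm \<Rightarrow> nat set" where
  "fv (Eq s t) = fv_trm s \<union> fv_trm t"
| "fv (Rel r ts) = (\<Union>t\<in>set ts. fv_trm t)"
| "fv (Neg \<phi>) = fv \<phi>"
| "fv (Conj \<phi> \<psi>) = fv \<phi> \<union> fv \<psi>"
| "fv (Ex x \<phi>) = fv \<phi> - {x}"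
| "fv (Hartig x y \<phi> \<psi>) = (fv \<phi> - {x}) \<union> (fv \<psi> - {y})"

primrec trm_of :: "'s lang \<Rightarrow> 's trm \<Rightarrow> bool" where
  "trm_of \<tau> (Var n) = True"
| "trm_of \<tau> (App f ts) =
     (f \<in> Funs \<tau> \<and> length ts = fun_ar \<tau> f \<and> list_all id (map (trm_of \<tau>) ts))"

primrec fm_of :: "'s lang \<Rightarrow> 's fm \<Rightarrow> bool" where
  "fm_of \<tau> (Eq s t) = (trm_of \<tau> s \<and> trm_of \<tau> t)"
| "fm_of \<tau> (Rel r ts) = (r \<in> Rels \<tau> \<and> length ts = rel_ar \<tau> r \<and> (\<forall>t\<in>set ts. trm_of \<tau> t))"
| "fm_of \<tau> (Neg \<phi>) = fm_of \<tau> \<phi>"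
| "fm_of \<tau> (Conj \<phi> \<psi>) = (fm_of \<tau> \<phi> \<and> fm_of \<tau> \<psi>)"
| "fm_of \<tau> (Ex x \<phi>) = fm_of \<tau> \<phi>"
| "fm_of \<tau> (Hartig x y \<phi> \<psi>) = (fm_of \<tau> \<phi> \<and> fm_of \<tau> \<psi>)"

primrec first_order :: "'s fm \<Rightarrow> bool" where
  "first_order (Eq s t) = True"
| "first_order (Rel r ts) = True"
| "first_order (Neg \<phi>) = first_order \<phi>"
| "first_order (Conj \<phi> \<psi>) = (first_order \<phi> \<and> first_order \<psi>)"
| "first_order (Ex x \<phi>) = first_order \<phi>"
| "first_order (Hartig x y \<phi> \<psi>) = False"

record ('s, 'v) struct =
  Dom :: "'v set"
  fun_int :: "'s \<Rightarrow> 'v list \<Rightarrow> 'v"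
  rel_int :: "'s \<Rightarrow> 'v list \<Rightarrow> bool"

primrec val :: "('s, 'v) struct \<Rightarrow> (nat \<Rightarrow> 'v) \<Rightarrow> 's trm \<Rightarrow> 'v" where
  "val A e (Var n) = e n"
| "val A e (App f ts) = fun_int A f (map (val A e) ts)"

primrec sat :: "('s, 'v) struct \<Rightarrow> (nat \<Rightarrow> 'v) \<Rightarrow> 's fm \<Rightarrow> bool" where
  "sat A e (Eq s t) = (val A e s = val A e t)"
| "sat A e (Rel r ts) = rel_int A r (map (val A e) ts)"
| "sat A e (Neg \<phi>) = (\<not> sat A e \<phi>)"
| "sat A e (Conj \<phi> \<psi>) = (sat A e \<phi> \<and> sat A e \<psi>)"
| "sat A e (Ex x \<phi>) = (\<exists>a\<in>Dom A. sat A (e(x := a)) \<phi>)"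
| "sat A e (Hartig x y \<phi> \<psi>) =
     ({a \<in> Dom A. sat A (e(x := a)) \<phi>} \<approx> {b \<in> Dom A. sat A (e(y := b)) \<psi>})"

definition sentence_of :: "'s lang \<Rightarrow> 's fm \<Rightarrow> bool" where
  "sentence_of \<tau> \<phi> \<longleftrightarrow> fm_of \<tau> \<phi> \<and> fv \<phi> = {}"

definition models :: "('s, 'v) struct \<Rightarrow> 's fm \<Rightarrow> bool"  (infix "\<Turnstile>" 50) where
  "A \<Turnstile> \<phi> \<longleftrightarrow> (\<forall>e. range e \<subseteq> Dom A \<longrightarrow> sat A e \<phi>)"

definition structure_of :: "'s lang \<Rightarrow> ('s, 'v::zfc) struct \<Rightarrow> bool" where
  "structure_of \<tau> A \<longleftrightarrow> Dom A \<noteq> {} \<and> small (Dom A) \<and>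
     (\<forall>f\<in>Funs \<tau>. \<forall>xs\<in>lists (Dom A). length xs = fun_ar \<tau> f \<longrightarrow> fun_int A f xs \<in> Dom A)"

definition substructure :: "'s lang \<Rightarrow> ('s, 'v) struct \<Rightarrow> ('s, 'v) struct \<Rightarrow> bool" where
  "substructure \<tau> A B \<longleftrightarrow> Dom A \<subseteq> Dom B \<and>
     (\<forall>f\<in>Funs \<tau>. \<forall>xs\<in>lists (Dom A). length xs = fun_ar \<tau> f \<longrightarrow> fun_int A f xs = fun_int B f xs) \<and>
     (\<forall>r\<in>Rels \<tau>. \<forall>xs\<in>lists (Dom A). length xs = rel_ar \<tau> r \<longrightarrow> rel_int A r xs = rel_int B r xs)"


section \<open>The upward Loewenheim-Skolem-Tarski number\<close>

definition ULST_property :: "'v::zfc \<Rightarrow> bool" where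
  "ULST_property \<delta> \<longleftrightarrow>
     (\<forall>(\<tau>::'v lang) \<phi> (A::('v, 'v) struct) \<gamma> \<gamma>'.
        small (Funs \<tau>) \<and> small (Rels \<tau>) \<and> sentence_of \<tau> \<phi> \<and>
        structure_of \<tau> A \<and> A \<Turnstile> \<phi> \<and>
        Card \<gamma> \<and> Dom A \<approx> elts \<gamma> \<and> \<delta> \<^bold>\<le> \<gamma> \<and> Card \<gamma>' \<and> \<gamma> \<^bold>\<in> \<gamma>' \<longrightarrow>
        (\<exists>B. structure_of \<tau> B \<and> B \<Turnstile> \<phi> \<and> elts \<gamma>' \<lesssim> Dom B \<and> substructure \<tau> A B))"

definition is_ULST :: "'v::zfc \<Rightarrow> bool" where
  "is_ULST \<delta> \<longleftrightarrow> Card \<delta> \<and> ULST_property \<delta> \<and>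
     (\<forall>\<delta>'. Card \<delta>' \<and> ULST_property \<delta>' \<longrightarrow> \<delta> \<^bold>\<le> \<delta>')"


section \<open>Cardinal correct extendibility\<close>

definition set_lang :: "unit lang" where
  "set_lang = \<lparr>Funs = {}, Rels = {()}, fun_ar = (\<lambda>_. 0), rel_ar = (\<lambda>_. 2)\<rparr>"

definition mem_struct :: "'v::zfc set \<Rightarrow> (unit, 'v) struct" where
  "mem_struct X = \<lparr>Dom = X, fun_int = undefined, rel_int = (\<lambda>_ xs. xs ! 0 \<^bold>\<in> xs ! 1)\<rparr>"

definition elementary_embedding ::
    "'s lang \<Rightarrow> ('s, 'v) struct \<Rightarrow> ('s, 'v) struct \<Rightarrow> ('v \<Rightarrow> 'v) \<Rightarrow> bool" where
  "elementary_embedding \<tau> A B j \<longleftrightarrow> j ` Dom A \<subseteq> Dom B \<and>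
     (\<forall>\<phi> e. fm_of \<tau> \<phi> \<and> first_order \<phi> \<and> range e \<subseteq> Dom A \<longrightarrow>
        (sat A e \<phi> \<longleftrightarrow> sat B (j \<circ> e) \<phi>))"

definition critical_point :: "'v::zfc set \<Rightarrow> ('v \<Rightarrow> 'v) \<Rightarrow> 'v \<Rightarrow> bool" where
  "critical_point X j \<kappa> \<longleftrightarrow> Ord \<kappa> \<and> \<kappa> \<in> X \<and> j \<kappa> \<noteq> \<kappa> \<and> (\<forall>\<xi>\<in>elts \<kappa>. j \<xi> = \<xi>)"

definition cc_extendible_pushing_up :: "'v::zfc \<Rightarrow> 'v \<Rightarrow> bool" where
  "cc_extendible_pushing_up \<kappa> \<gamma> \<longleftrightarrow>
     (\<forall>\<alpha>. Ord \<alpha> \<and> \<gamma> \<^bold>\<in> \<alpha> \<longrightarrow>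
        (\<exists>M j. small M \<and> transitive_class M \<and> cardinal_correct M \<and>
           elementary_embedding set_lang (mem_struct (V_stage \<alpha>)) (mem_struct M) j \<and>
           critical_point (V_stage \<alpha>) j \<kappa> \<and> \<alpha> \<^bold>\<in> j \<gamma>))"

end

theory Submission
  imports Defs "HOL-Library.Countable"
begin

text \<open>
  Suppose that every pair of cardinals \<open>\<kappa> \<le> \<gamma>\<close> fails at some ordinal \<open>bad \<kappa> \<gamma>\<close>. Above the ULST number,
  choose cardinals \<open>t 0 < t 1 < \<dots>\<close> with \<open>bad \<kappa> (t n) < t (n + 1)\<close> for all \<open>\<kappa> \<le> t n\<close>, and let \<open>\<theta>\<close> be
  their supremum. Expand \<open>V\<^sub>\<theta>\<close> by the satisfaction relation for its elements, the sequence \<open>t\<close> and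
  the stages of the hierarchy. A single sentence with the Haertig quantifier says that membership is
  extensional and well-founded (the sets of elements of rank smaller than that of \<open>x\<close> have cardinalities
  strictly increasing with respect to membership, and cardinalities are well-founded), that the
  cardinals of the stages are true cardinals, that satisfaction obeys Tarski's clauses, and that \<open>t\<close> is
  cofinal.

  An extension of cardinality greater than that of \<open>V\<^sub>\<theta>\<close> collapses to a transitive set, and the collapse
  restricts to elementary embeddings \<open>j\<close> of the stages \<open>V\<^sub>\<alpha>\<close> with \<open>\<alpha> < \<theta>\<close> into cardinal correct
  transitive sets. The sequence \<open>t\<close> has no new members in the extension by well-foundedness, so its
  images are cofinal there; as the extension is large, \<open>j (t n) \<ge> \<theta>\<close> for some \<open>n\<close>. If \<open>\<kappa>\<close> is the
  critical point, then \<open>\<kappa>\<close> pushes up \<open>t n\<close> at \<open>bad \<kappa> (t n)\<close>, a contradiction.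
\<close>

section \<open>Sets of the universe\<close>

lemma mem_iff_elts: "x \<^bold>\<in> y \<longleftrightarrow> x \<in> elts y"
  by (simp add: elts_def)

lemma elts_inject [simp]: "elts x = elts y \<longleftrightarrow> x = y"
  by (metis Extensionality mem_iff_elts)

text \<open>The inverse of \<open>elts\<close>. Its value at a class that is not small is
  unspecified, so computing with it requires a proof of smallness first.\<close>

definition set_of :: "'v::zfc set \<Rightarrow> 'v" where
  "set_of X = (THE x. elts x = X)"

lemma set_of_elts [simp]: "set_of (elts x) = x"
  by (simp add: set_of_def)

lemma elts_set_of [simp]: "small X \<Longrightarrow> elts (set_of X) = X"
  by (auto simp: small_def)

lemma small_elts [simp]: "small (elts x)"
  by (auto simp: small_def)

section \<open>Closure properties of small classes\<close>

lemma small_subset: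
  assumes "small X" "Y \<subseteq> X"
  shows "small Y"
proof -
  obtain x where x: "X = elts x" using assms(1) by (auto simp: small_def)
  obtain y where "\<forall>z. z \<^bold>\<in> y \<longleftrightarrow> z \<^bold>\<in> x \<and> z \<in> Y" using Separation[of x "\<lambda>z. z \<in> Y"] by blast
  then have "Y = elts y" using x assms(2) by (auto simp: elts_def)
  then show ?thesis by (auto simp: small_def)
qed

lemma small_image [simp]:
  fixes f :: "'v::zfc \<Rightarrow> 'v"
  assumes "small X"
  shows "small (f ` X)"
proof -
  obtain x where x: "X = elts x" using assms(1) by (auto simp: small_def)
  obtain y where "\<forall>z. z \<^bold>\<in> y \<longleftrightarrow> (\<exists>w. w \<^bold>\<in> x \<and> z = f w)" using Replacement[of x f] by blast
  then have "f ` X = elts y" using x by (auto simp: elts_def)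
  then show ?thesis by (auto simp: small_def)
qed

text \<open>Replacement collects the sets coding the classes \<open>F x\<close>, and Union flattens
  the collection.\<close>

lemma small_UN:
  fixes F :: "'v::zfc \<Rightarrow> 'v set"
  assumes "small X" and F: "\<And>x. x \<in> X \<Longrightarrow> small (F x)"
  shows "small (\<Union>x\<in>X. F x)"
proof -
  obtain r where r: "elts r = (\<lambda>x. set_of (F x)) ` X"
    using small_image[OF assms(1)] by (metis small_def)
  obtain u where "\<forall>z. z \<^bold>\<in> u \<longleftrightarrow> (\<exists>y. y \<^bold>\<in> r \<and> z \<^bold>\<in> y)" using Union[of r] by blast
  then have "elts u = (\<Union>y\<in>elts r. elts y)" by (auto simp: elts_def)
  also have "\<dots> = (\<Union>x\<in>X. F x)" using r F by simp
  finally show ?thesis by (metis small_def)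
qed

lemma small_Collect_subset:
  assumes "small X"
  shows "small {x. elts x \<subseteq> X}"
proof -
  obtain x where x: "X = elts x" using assms(1) by (auto simp: small_def)
  obtain p where "\<forall>z. z \<^bold>\<in> p \<longleftrightarrow> (\<forall>w. w \<^bold>\<in> z \<longrightarrow> w \<^bold>\<in> x)" using Power[of x] by blast
  then have "{x. elts x \<subseteq> X} = elts p" using x by (auto simp: elts_def)
  then show ?thesis by (auto simp: small_def)
qed

lemma small_pair [simp]: "small {x, y}"
proof -
  obtain p where "\<forall>z. z \<^bold>\<in> p \<longleftrightarrow> z = x \<or> z = y" using Pairing[of x y] by blast
  then have "{x, y} = elts p" by (auto simp: elts_def)
  then show ?thesis by (auto simp: small_def)
qed

lemma small_empty [simp]: "small {}"
  using small_subset[OF small_elts] by blast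

lemma small_Un [simp]:
  assumes "small X" "small Y"
  shows "small (X \<union> Y)"
proof -
  have "X \<union> Y = (\<Union>x\<in>{set_of X, set_of Y}. elts x)" using assms by simp
  then show ?thesis using small_UN[OF small_pair] small_elts by metis
qed

lemma small_insert [simp]: "small X \<Longrightarrow> small (insert x X)"
  using small_Un[OF small_pair[of x x]] by simp

section \<open>Induction along membership\<close>

lemma mem_induct [case_names mem]:
  assumes "\<And>x::'v::zfc. (\<And>y. y \<in> elts x \<Longrightarrow> P y) \<Longrightarrow> P x"
  shows "P x"
  using wf_mem by (rule wf_induct) (use assms in \<open>auto simp: mem_iff_elts\<close>)

lemma ex_mem_minimal:
  fixes x :: "'v::zfc"
  assumes "P x"
  shows "\<exists>x::'v. P x \<and> (\<forall>y\<in>elts x. \<not> P y)"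
proof (rule ccontr)
  assume *: "\<not> ?thesis"
  have "\<not> P y" for y by (induction y rule: mem_induct) (use * in blast)
  then show False using assms by blast
qed

lemma mem_not_refl [simp]: "x \<notin> elts x"
  by (induction x rule: mem_induct) auto

lemma mem_asym: "x \<in> elts y \<Longrightarrow> y \<notin> elts x"
  by (induction x arbitrary: y rule: mem_induct) auto

section \<open>Successors, numerals and omega\<close>

definition suc :: "'v::zfc \<Rightarrow> 'v" where
  "suc x = set_of (insert x (elts x))"

lemma elts_suc [simp]: "elts (suc x) = insert x (elts x)"
  by (simp add: suc_def)

lemma suc_inject [simp]: "suc x = suc y \<longleftrightarrow> x = y"
proof
  assume "suc x = suc y"
  then have "insert x (elts x) = insert y (elts y)" by (metis elts_suc)
  then have "x \<in> insert y (elts y)" "y \<in> insert x (elts x)" by auto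
  then show "x = y" using mem_asym[of x y] by auto
qed simp

text \<open>The von Neumann numerals. They serve as natural numbers, as symbols of the language, as
  codes of formulas and as indices of variables in coded assignments.\<close>

primrec num :: "nat \<Rightarrow> 'v::zfc" where
  "num 0 = set_of {}"
| "num (Suc n) = suc (num n)"

lemma elts_num: "elts (num n) = num ` {..<n}"
  by (induction n) (auto simp: lessThan_Suc)

lemma inj_num: "inj (num :: nat \<Rightarrow> 'v::zfc)"
proof (rule injI)
  fix m n :: nat assume eq: "num m = (num n :: 'v)"
  have "i \<noteq> j" if "num i = (num j :: 'v)" "i < j" for i j
    using that by (metis elts_num image_eqI lessThan_iff mem_not_refl)
  then show "m = n" using eq by (metis elts_num image_eqI lessThan_iff mem_not_refl nat_neq_iff)
qed

lemma num_eq_iff [simp]: "num m = num n \<longleftrightarrow> m = n"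
  by (rule inj_eq[OF inj_num])

text \<open>An inductive set provided by Infinity contains every numeral, by induction in HOL, and
  Separation cuts it down.\<close>

lemma small_range_num: "small (range num :: 'v::zfc set)"
proof -
  obtain I e where I: "e \<^bold>\<in> I" "\<forall>z. \<not> z \<^bold>\<in> (e::'v)"
      "\<forall>y. y \<^bold>\<in> I \<longrightarrow> (\<exists>s. s \<^bold>\<in> I \<and> (\<forall>z. z \<^bold>\<in> s \<longleftrightarrow> z \<^bold>\<in> y \<or> z = y))"
    using Infinity by metis
  have "elts e = {}" using I(2) by (auto simp: elts_def)
  then have e: "e = num 0" by (metis num.simps(1) set_of_elts)
  have "num n \<in> elts I" for n
  proof (induction n)
    case 0
    then show ?case using I(1) e by (simp add: mem_iff_elts)
  next
    case (Suc n)
    then obtain s where s: "s \<in> elts I" "\<forall>z. z \<in> elts s \<longleftrightarrow> z \<in> elts (num n) \<or> z = num n"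
      using I(3) by (auto simp: mem_iff_elts)
    have "elts s = elts (suc (num n))" unfolding elts_suc using s(2) by blast
    then have "s = suc (num n)" by (simp only: elts_inject)
    then have "s = num (Suc n)" by simp
    then show ?case using s(1) by simp
  qed
  then show ?thesis using small_subset[OF small_elts, of "range num" I] by blast
qed

text \<open>Replacement speaks of functions on the universe, so \<open>f\<close> is reindexed along
  the numerals.\<close>

lemma small_range_nat [simp]:
  fixes f :: "nat \<Rightarrow> 'v::zfc"
  shows "small (range f)"
proof -
  have "range f = (\<lambda>x. f (the_inv num x)) ` range (num :: nat \<Rightarrow> 'v)"
    by (auto simp: image_image the_inv_f_f[OF inj_num])
  then show ?thesis using small_image[OF small_range_num] by metis
qed

definition omega :: "'v::zfc" where
  "omega = set_of (range num)"

lemma elts_omega [simp]: "elts omega = range num"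
  by (simp add: omega_def small_range_num)

text \<open>Kuratowski pairs, for coded assignments. The rank they add is harmless there, since such
  assignments merely have to lie in \<open>V_stage \<theta>\<close> for a limit
  \<open>\<theta>\<close>.\<close>

definition kpair :: "'v::zfc \<Rightarrow> 'v \<Rightarrow> 'v" where
  "kpair x y = set_of {set_of {x}, set_of {x, y}}"

lemma kpair_inject [simp]: "kpair x y = kpair x' y' \<longleftrightarrow> x = x' \<and> y = y'"
proof
  have s: "elts (kpair x y) = {set_of {x}, set_of {x, y}}" for x y :: 'a
    by (simp add: kpair_def)
  have i: "set_of X = set_of Y \<longleftrightarrow> X = Y" if "small X" "small Y" for X Y :: "'a set"
    using that by (metis elts_set_of)
  assume "kpair x y = kpair x' y'"
  then have "{set_of {x}, set_of {x, y}} = {set_of {x'}, set_of {x', y'}}"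
    using s by metis
  then show "x = x' \<and> y = y'"
    by (auto simp: doubleton_eq_iff i)
qed simp

section \<open>Ordinals and cardinals\<close>

lemma Ord_iff: "Ord \<alpha> \<longleftrightarrow> (\<forall>\<beta>\<in>elts \<alpha>. elts \<beta> \<subseteq> elts \<alpha> \<and> (\<forall>\<gamma>\<in>elts \<beta>. elts \<gamma> \<subseteq> elts \<beta>))"
  unfolding Ord_def transitive_class_def by blast

lemma Ord_in_Ord: "Ord \<alpha> \<Longrightarrow> \<beta> \<in> elts \<alpha> \<Longrightarrow> Ord \<beta>"
  unfolding Ord_iff by (meson in_mono)

lemma Ord_trans: "Ord \<alpha> \<Longrightarrow> \<beta> \<in> elts \<alpha> \<Longrightarrow> \<gamma> \<in> elts \<beta> \<Longrightarrow> \<gamma> \<in> elts \<alpha>"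
  unfolding Ord_iff by blast

text \<open>Double induction along membership: if the ordinals were distinct and neither an element
  of the other, the induction hypotheses would give them the same elements.\<close>

lemma Ord_linear:
  assumes "Ord \<alpha>" "Ord \<beta>"
  obtains "\<alpha> \<in> elts \<beta>" | "\<alpha> = \<beta>" | "\<beta> \<in> elts \<alpha>"
proof -
  have "\<forall>\<beta>. Ord \<alpha> \<longrightarrow> Ord \<beta> \<longrightarrow> \<alpha> \<in> elts \<beta> \<or> \<alpha> = \<beta> \<or> \<beta> \<in> elts \<alpha>"
  proof (induction \<alpha> rule: mem_induct)
    case (mem \<alpha>)
    show ?case
    proof
      fix \<beta>
      show "Ord \<alpha> \<longrightarrow> Ord \<beta> \<longrightarrow> \<alpha> \<in> elts \<beta> \<or> \<alpha> = \<beta> \<or> \<beta> \<in> elts \<alpha>"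
      proof (induction \<beta> rule: mem_induct)
        case IH: (mem \<beta>)
        show ?case
        proof (intro impI)
          assume o: "Ord \<alpha>" "Ord \<beta>"
          show "\<alpha> \<in> elts \<beta> \<or> \<alpha> = \<beta> \<or> \<beta> \<in> elts \<alpha>"
          proof (rule ccontr)
            assume n: "\<not> ?thesis"
            have "x \<in> elts \<beta>" if "x \<in> elts \<alpha>" for x
              using mem that n o by (metis Ord_in_Ord Ord_trans)
            moreover have "x \<in> elts \<alpha>" if "x \<in> elts \<beta>" for x
              using IH that n o by (metis Ord_in_Ord Ord_trans)
            ultimately have "elts \<alpha> = elts \<beta>" by blast
            then show False using n by simp
          qed
        qed
      qed
    qed
  qed
  then show ?thesis using assms that by blast
qed

lemma Ord_subset_cases:
  assumes "Ord \<alpha>" "Ord \<beta>" "elts \<alpha> \<subseteq> elts \<beta>"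
  shows "\<alpha> \<in> elts \<beta> \<or> \<alpha> = \<beta>"
  using Ord_linear[OF assms(1,2)] assms(3) mem_not_refl by blast

lemma Ord_suc: "Ord \<alpha> \<Longrightarrow> Ord (suc \<alpha>)"
  unfolding Ord_iff by auto

lemma Ord_num [simp]: "Ord (num n)"
proof (induction n)
  case 0
  then show ?case by (simp add: Ord_iff)
qed (simp add: Ord_suc)

lemma Ord_omega [simp]: "Ord omega"
  unfolding Ord_iff by (auto simp: elts_num)

lemma Ord_Union:
  assumes "small X" "\<And>x. x \<in> X \<Longrightarrow> Ord x"
  shows "Ord (set_of (\<Union>x\<in>X. elts x))"
proof -
  have "elts (set_of (\<Union>x\<in>X. elts x)) = (\<Union>x\<in>X. elts x)"
    by (intro elts_set_of small_UN) (use assms in auto)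
  then show ?thesis using assms(2) unfolding Ord_iff by (auto; meson subsetD)
qed

section \<open>The Mostowski collapse and the existence of cardinals\<close>

definition collapse :: "('v::zfc \<times> 'v) set \<Rightarrow> 'v \<Rightarrow> 'v" where
  "collapse r = wfrec r (\<lambda>f x. set_of (f ` {y. (y, x) \<in> r}))"

text \<open>Only predecessors of \<open>x\<close> are visited, so restricting the recursion by
  \<open>cut\<close> does no harm. The collapse is used twice: to turn a well-order into an ordinal,
  and an extension of the tower structure into a transitive set.\<close>

lemma elts_collapse:
  assumes "wf r" "small {y. (y, x) \<in> r}"
  shows "elts (collapse r x) = collapse r ` {y. (y, x) \<in> r}"
proof -
  have "collapse r x = set_of (cut (collapse r) r x ` {y. (y, x) \<in> r})"
    unfolding collapse_def by (subst wfrec[OF assms(1)]) simp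
  also have "cut (collapse r) r x ` {y. (y, x) \<in> r} = collapse r ` {y. (y, x) \<in> r}"
    by (intro image_cong) (auto simp: cut_apply)
  finally show ?thesis using assms(2) by simp
qed

lemma ex_Ord_eqpoll:
  fixes X :: "'v::zfc set"
  assumes "small X"
  shows "\<exists>\<alpha>::'v. Ord \<alpha> \<and> elts \<alpha> \<approx> X"
proof -
  obtain r where r: "well_order_on X r" using well_order_on by blast
  define E where "E = r - Id"
  have wfE: "wf E" using r by (simp add: well_order_on_def E_def)
  have EX: "E \<subseteq> X \<times> X"
    using r by (auto simp: well_order_on_def linear_order_on_def partial_order_on_def
        preorder_on_def refl_on_def E_def)
  have tr: "trans E"
    using r by (auto simp: well_order_on_def linear_order_on_def partial_order_on_def
        preorder_on_def E_def intro: trans_diff_Id)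
  have tot: "(x, y) \<in> E \<or> (y, x) \<in> E" if "x \<in> X" "y \<in> X" "x \<noteq> y" for x y
    using r that by (auto simp: well_order_on_def linear_order_on_def total_on_def E_def)
  let ?f = "collapse E"
  have f: "elts (?f x) = ?f ` {y. (y, x) \<in> E}" for x
    by (rule elts_collapse[OF wfE small_subset[OF assms]]) (use EX in auto)
  \<comment> \<open>Distinct points are comparable, so equal values would be elements of
    themselves.\<close>
  have "inj_on ?f X"
  proof (rule inj_onI, rule ccontr)
    fix x y assume xy: "x \<in> X" "y \<in> X" "?f x = ?f y" "x \<noteq> y"
    then have "?f x \<in> elts (?f y) \<or> ?f y \<in> elts (?f x)" using tot f by blast
    then show False using xy(3) by simp
  qed
  then have "?f ` X \<approx> X" by (metis eqpoll_sym inj_on_image_eqpoll_self)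
  moreover have "Ord (set_of (?f ` X))"
  proof -
    have "elts (?f y) \<subseteq> ?f ` X" for y using EX by (auto simp: f)
    moreover have "elts z \<subseteq> elts (?f x)" if "z \<in> elts (?f x)" for x z
      using that by (auto simp: f intro!: imageI dest: transD[OF tr])
    ultimately show ?thesis unfolding Ord_iff using assms by (auto; meson subsetD)
  qed
  ultimately show ?thesis using assms by (metis elts_set_of small_image)
qed

text \<open>The least ordinal equipollent with \<open>X\<close> has no equipollent element.\<close>

lemma ex_Card_eqpoll:
  fixes X :: "'v::zfc set"
  assumes "small X"
  shows "\<exists>\<gamma>::'v. Card \<gamma> \<and> elts \<gamma> \<approx> X"
proof -
  obtain \<alpha> :: 'v where "Ord \<alpha> \<and> elts \<alpha> \<approx> X" using ex_Ord_eqpoll[OF assms] by blast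
  then have "\<exists>\<gamma>::'v. (Ord \<gamma> \<and> elts \<gamma> \<approx> X) \<and> (\<forall>\<beta>\<in>elts \<gamma>. \<not> (Ord \<beta> \<and> elts \<beta> \<approx> X))"
    by (rule ex_mem_minimal)
  then obtain \<gamma> :: 'v where \<gamma>: "Ord \<gamma>" "elts \<gamma> \<approx> X"
      "\<And>\<beta>. \<beta> \<in> elts \<gamma> \<Longrightarrow> \<not> (Ord \<beta> \<and> elts \<beta> \<approx> X)"
    by blast
  have "\<not> elts \<beta> \<approx> elts \<gamma>" if "\<beta> \<in> elts \<gamma>" for \<beta>
    using \<gamma> that by (meson Ord_in_Ord eqpoll_trans)
  then show ?thesis using \<gamma> by (auto simp: Card_def)
qed

text \<open>Cantor's theorem: every subclass of a small class is small, so these sets correspond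
  exactly to the HOL powerset of \<open>X\<close>.\<close>

lemma lesspoll_Collect_subset:
  assumes "small X"
  shows "X \<prec> {x. elts x \<subseteq> X}"
proof -
  have "bij_betw elts {x. elts x \<subseteq> X} (Pow X)"
    by (rule bij_betwI[where g = set_of]) (use small_subset[OF assms] in auto)
  then show ?thesis
    using lesspoll_Pow_self eqpoll_sym lesspoll_eq_trans by (metis eqpoll_def)
qed

text \<open>If the ordinal \<open>a\<close> bounds \<open>X\<close> strictly, the cardinality of its
  power set cannot be included in \<open>a\<close>, and so it includes \<open>a\<close>.\<close>

lemma ex_Card_above:
  fixes X :: "'v::zfc set"
  assumes "small X" "\<And>x. x \<in> X \<Longrightarrow> Ord x"
  shows "\<exists>\<gamma>. Card \<gamma> \<and> X \<subseteq> elts \<gamma>"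
proof -
  define a where "a = suc (set_of (\<Union>x\<in>X. elts x))"
  have sm: "small (\<Union>x\<in>X. elts x)" by (intro small_UN) (use assms in auto)
  have oa: "Ord a" unfolding a_def by (intro Ord_suc Ord_Union) (use assms in auto)
  have Xa: "X \<subseteq> elts a"
  proof
    fix x assume x: "x \<in> X"
    have "x \<in> elts (set_of (\<Union>x\<in>X. elts x)) \<or> x = set_of (\<Union>x\<in>X. elts x)"
      by (intro Ord_subset_cases Ord_Union) (use assms x sm in auto)
    then show "x \<in> elts a" by (auto simp: a_def)
  qed
  obtain c :: 'v where c: "Card c" "elts c \<approx> {x. elts x \<subseteq> elts a}"
    using ex_Card_eqpoll[OF small_Collect_subset[OF small_elts]] by blast
  have "elts a \<prec> elts c"
    using lesspoll_Collect_subset[OF small_elts] c(2) eqpoll_sym lesspoll_eq_trans by blast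
  then have n: "\<not> elts c \<subseteq> elts a"
    by (meson lepoll_antisym lesspoll_def subset_imp_lepoll)
  have oc: "Ord c" using c(1) by (simp add: Card_def)
  have "elts a \<subseteq> elts c"
    using Ord_linear[OF oa oc] n Ord_trans[OF oa] Ord_trans[OF oc] by blast
  then show ?thesis using c(1) Xa by blast
qed

text \<open>Otherwise inclusion and the Schroeder-Bernstein theorem would make
  \<open>\<delta>\<close> equipollent with its element \<open>\<gamma>\<close>.\<close>

lemma Card_le_Card:
  assumes "Card \<delta>" "Card \<gamma>" "elts \<delta> \<lesssim> elts \<gamma>"
  shows "\<delta> \<^bold>\<le> \<gamma>"
proof (rule ccontr)
  assume "\<not> \<delta> \<^bold>\<le> \<gamma>"
  then have "\<gamma> \<in> elts \<delta>"
    using Ord_linear[of \<delta> \<gamma>] assms by (auto simp: Card_def ord_le_def mem_iff_elts)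
  moreover from this have "elts \<gamma> \<lesssim> elts \<delta>"
    using assms Ord_trans by (metis Card_def subsetI subset_imp_lepoll)
  ultimately show False using assms by (meson Card_def lepoll_antisym)
qed

section \<open>Stages of the cumulative hierarchy\<close>

lemma V_stage_iff: "z \<in> V_stage x \<longleftrightarrow> (\<exists>y\<in>elts x. elts z \<subseteq> V_stage y)"
  by (subst V_stage.simps) simp

lemma V_stage_trans: "z \<in> V_stage x \<Longrightarrow> w \<in> elts z \<Longrightarrow> w \<in> V_stage x"
proof (induction x arbitrary: z w rule: mem_induct)
  case (mem x)
  then obtain y where y: "y \<in> elts x" "elts z \<subseteq> V_stage y" by (auto simp: V_stage_iff)
  then have "elts w \<subseteq> V_stage y" using mem by blast
  then show ?case using y by (auto simp: V_stage_iff)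
qed

lemma V_stage_mono: "elts x \<subseteq> elts y \<Longrightarrow> V_stage x \<subseteq> V_stage y"
  using V_stage_iff by blast

text \<open>The recursion for \<open>V_stage\<close> makes sense at every set, and
  \<open>V_stage x\<close> is the stage indexed by the rank of \<open>x\<close>. The premise thus
  says that the rank of \<open>y\<close> is at most that of \<open>x\<close>.\<close>

lemma V_stage_subset: "elts y \<subseteq> V_stage x \<Longrightarrow> V_stage y \<subseteq> V_stage x"
proof (induction y arbitrary: x rule: mem_induct)
  case (mem y)
  show ?case
  proof
    fix z assume "z \<in> V_stage y"
    then obtain u where u: "u \<in> elts y" "elts z \<subseteq> V_stage u" by (auto simp: V_stage_iff)
    then obtain v where v: "v \<in> elts x" "elts u \<subseteq> V_stage v" using mem.prems V_stage_iff by blast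
    then have "elts z \<subseteq> V_stage v" using mem.IH[OF u(1)] u(2) by blast
    then show "z \<in> V_stage x" using v V_stage_iff by blast
  qed
qed

lemma elts_subset_V_stage: "elts x \<subseteq> V_stage x"
proof (induction x rule: mem_induct)
  case (mem x)
  then show ?case using V_stage_iff by blast
qed

lemma small_V_stage [simp]: "small (V_stage x)"
  by (induction x rule: mem_induct) (subst V_stage.simps, blast intro: small_UN small_Collect_subset small_elts)

text \<open>Every set of elements of the smaller stage belongs to the larger one, so Cantor's
  theorem applies. This strict growth is what the Haertig quantifier will express to force
  well-foundedness.\<close>

lemma V_stage_lesspoll:
  assumes "y \<in> elts x"
  shows "V_stage y \<subseteq> V_stage x" "\<not> V_stage y \<approx> V_stage x"
proof -
  show s: "V_stage y \<subseteq> V_stage x" using assms V_stage_trans V_stage_iff by blast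
  have "{z. elts z \<subseteq> V_stage y} \<subseteq> V_stage x" using assms V_stage_iff by blast
  then have "V_stage y \<prec> V_stage x"
    using lesspoll_Collect_subset[OF small_V_stage] lesspoll_trans2 subset_imp_lepoll by metis
  then show "\<not> V_stage y \<approx> V_stage x" by (simp add: lesspoll_def)
qed

lemma set_of_in_V_stage: "X \<subseteq> V_stage \<beta> \<Longrightarrow> \<beta> \<in> elts \<alpha> \<Longrightarrow> set_of X \<in> V_stage \<alpha>"
  unfolding V_stage_iff using small_subset[OF small_V_stage] elts_set_of by metis

text \<open>By induction, the elements of \<open>x\<close> lie below the index
  \<open>\<beta>\<close> that bounds their ranks, whence \<open>x\<close> is at most
  \<open>\<beta>\<close>.\<close>

lemma Ord_in_V_stage:
  assumes "Ord \<alpha>" "Ord x" "x \<in> V_stage \<alpha>"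
  shows "x \<in> elts \<alpha>"
  using assms
proof (induction x arbitrary: \<alpha> rule: mem_induct)
  case (mem x)
  then obtain \<beta> where \<beta>: "\<beta> \<in> elts \<alpha>" "elts x \<subseteq> V_stage \<beta>" by (auto simp: V_stage_iff)
  then have "elts x \<subseteq> elts \<beta>" using mem Ord_in_Ord by blast
  moreover have "Ord \<beta>" using Ord_in_Ord[OF mem.prems(1) \<beta>(1)] .
  ultimately have "x \<in> elts \<beta> \<or> x = \<beta>" using Ord_subset_cases[OF mem.prems(2)] by blast
  then show ?case using \<beta>(1) Ord_trans[OF mem.prems(1) \<beta>(1)] by blast
qed

section \<open>Cardinals of the stages\<close>

definition shift :: "'v::zfc \<Rightarrow> 'v" where
  "shift x = (if x \<in> range num then suc x else x)"

definition flat_left :: "'v::zfc \<Rightarrow> 'v" where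
  "flat_left x = set_of (shift ` elts x)"

definition flat_right :: "'v::zfc \<Rightarrow> 'v" where
  "flat_right x = set_of (insert (num 0) (shift ` elts x))"

definition flat_pair :: "'v::zfc \<Rightarrow> 'v \<Rightarrow> 'v" where
  "flat_pair a b = set_of (flat_left ` elts a \<union> flat_right ` elts b)"

lemma elts_flat_left: "elts (flat_left x) = shift ` elts x"
  by (simp add: flat_left_def)

lemma elts_flat_right: "elts (flat_right x) = insert (num 0) (shift ` elts x)"
  by (simp add: flat_right_def)

lemma elts_flat_pair: "elts (flat_pair a b) = flat_left ` elts a \<union> flat_right ` elts b"
  by (simp add: flat_pair_def)

lemma suc_num: "suc (num n) = num (Suc n)"
  by simp

lemma suc_in_range_num: "x \<in> range num \<Longrightarrow> suc x \<in> range num"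
  using suc_num by blast

lemma inj_shift: "inj (shift :: 'v::zfc \<Rightarrow> 'v)"
proof (rule injI)
  fix x y :: 'v assume eq: "shift x = shift y"
  show "x = y"
  proof (cases "x \<in> range num"; cases "y \<in> range num")
    assume "x \<in> range num" "y \<notin> range num"
    then show ?thesis using eq suc_in_range_num[of x] by (simp add: shift_def)
  next
    assume "x \<notin> range num" "y \<in> range num"
    then show ?thesis using eq suc_in_range_num[of y] by (simp add: shift_def)
  qed (use eq in \<open>auto simp: shift_def\<close>)
qed

text \<open>Shifting keeps zero free as the tag that tells \<open>flat_right\<close> from
  \<open>flat_left\<close>.\<close>

lemma num_0_not_shift: "num 0 \<noteq> shift x"
proof
  assume *: "num 0 = shift x"
  show False
  proof (cases "x \<in> range num")
    case True
    then obtain n where n: "x = num n" by blast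
    have "num 0 = (num (Suc n) :: 'a)" using * n by (simp add: shift_def del: num.simps(1))
    then show False unfolding num_eq_iff by simp
  next
    case False
    then show False using * by (auto simp: shift_def simp del: num.simps(1))
  qed
qed

lemma flat_left_inject: "flat_left x = flat_left y \<longleftrightarrow> x = y"
  by (metis elts_flat_left elts_inject inj_image_eq_iff inj_shift)

lemma flat_right_inject: "flat_right x = flat_right y \<longleftrightarrow> x = y"
proof
  assume "flat_right x = flat_right y"
  then have eq: "insert (num 0) (shift ` elts x) = insert (num 0) (shift ` elts y)"
    by (metis elts_flat_right)
  have n: "num 0 \<notin> shift ` elts z" for z :: 'a
    using num_0_not_shift by blast
  have "shift ` elts x = shift ` elts y" using eq insert_ident[OF n n] by metis
  then show "x = y" by (metis elts_inject inj_image_eq_iff inj_shift)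
qed simp

lemma flat_left_neq_right: "flat_left x \<noteq> flat_right y"
proof
  assume "flat_left x = flat_right y"
  then have "num 0 \<in> shift ` elts x" by (metis elts_flat_left elts_flat_right insertI1)
  then show False using num_0_not_shift by blast
qed

text \<open>The tag makes the union disjoint, so each component is the preimage of the pair under
  one of two injective functions.\<close>

lemma flat_pair_inject: "flat_pair a b = flat_pair a' b' \<longleftrightarrow> a = a' \<and> b = b'"
proof
  assume "flat_pair a b = flat_pair a' b'"
  then have eq: "flat_left ` elts a \<union> flat_right ` elts b = flat_left ` elts a' \<union> flat_right ` elts b'"
    by (metis elts_flat_pair)
  have "elts a = {c. flat_left c \<in> flat_left ` elts a \<union> flat_right ` elts b}" for a b :: 'a
    by (auto simp: flat_left_inject flat_left_neq_right)
  then have "elts a = elts a'" using eq by metis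
  have "elts b = {c. flat_right c \<in> flat_left ` elts a \<union> flat_right ` elts b}" for a b :: 'a
    by (auto simp: flat_right_inject flat_left_neq_right[symmetric])
  then have "elts b = elts b'" using eq by metis
  show "a = a' \<and> b = b'" using \<open>elts a = elts a'\<close> \<open>elts b = elts b'\<close> by simp
qed simp

section \<open>Absoluteness of the relativised notions\<close>

lemma empty_in_iff:
  assumes "transitive_class M" "x \<in> M"
  shows "empty_in M x \<longleftrightarrow> x = num 0"
proof -
  have "empty_in M x \<longleftrightarrow> elts x = {}"
    using assms by (auto simp: empty_in_def mem_iff_elts transitive_class_def)
  also have "\<dots> \<longleftrightarrow> x = num 0" by (metis elts_inject elts_set_of num.simps(1) small_empty)
  finally show ?thesis .
qed

lemma succ_in_iff:
  assumes "transitive_class M" "x \<in> M" "y \<in> M"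
  shows "succ_in M x y \<longleftrightarrow> y = suc x"
proof -
  have "elts x \<subseteq> M" "elts y \<subseteq> M" using assms by (auto simp: transitive_class_def)
  then have "succ_in M x y \<longleftrightarrow> elts y = elts (suc x)"
    unfolding succ_in_def mem_iff_elts elts_suc using assms(2) by blast
  then show ?thesis by (simp only: elts_inject)
qed

lemma ord_in_iff:
  assumes "transitive_class M" "x \<in> M"
  shows "ord_in M x \<longleftrightarrow> Ord x"
proof -
  have sub: "elts y \<subseteq> M" if "y \<in> M" for y using assms(1) that by (auto simp: transitive_class_def)
  have tr: "trans_in M y \<longleftrightarrow> transitive_class (elts y)" if "y \<in> M" for y
    unfolding trans_in_def transitive_class_def mem_iff_elts using sub that by blast
  show ?thesis
    unfolding ord_in_def Ord_def mem_iff_elts using tr assms(2) sub by blast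
qed

lemma Ord_range_num_if:
  fixes n :: "'v::zfc"
  assumes "Ord n" "\<And>m. m = n \<or> m \<in> elts n \<Longrightarrow> m = num 0 \<or> (\<exists>k. m = suc k)"
  shows "n \<in> range num"
  using assms
proof (induction n rule: mem_induct)
  case (mem n)
  consider "n = num 0" | k where "n = suc k" using mem.prems(2) by blast
  then show ?case
  proof cases
    case 2
    then have k: "k \<in> elts n" by simp
    have "k \<in> range num"
      using mem.IH[OF k] mem.prems Ord_in_Ord[OF mem.prems(1) k] Ord_trans[OF mem.prems(1) k] k
      by blast
    then show ?thesis using 2 suc_num by (metis rangeE rangeI)
  qed blast
qed

lemma nat_in_iff:
  assumes "transitive_class M" "n \<in> M"
  shows "nat_in M n \<longleftrightarrow> n \<in> range num"
proof
  have sub: "elts y \<subseteq> M" if "y \<in> M" for y using assms(1) that by (auto simp: transitive_class_def)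
  {
    assume n: "nat_in M n"
    have o: "Ord n" using n ord_in_iff[OF assms] by (simp add: nat_in_def)
    have "m = num 0 \<or> (\<exists>k. m = suc k)" if "m = n \<or> m \<in> elts n" for m
    proof -
      have m: "m \<in> M" using that assms(2) sub by blast
      then have "empty_in M m \<or> (\<exists>k\<in>M. succ_in M k m)"
        using n that unfolding nat_in_def mem_iff_elts by blast
      then show ?thesis using empty_in_iff[OF assms(1) m] succ_in_iff[OF assms(1) _ m] by blast
    qed
    then show "n \<in> range num" using Ord_range_num_if[OF o] by blast
  }
  assume "n \<in> range num"
  then obtain i where i: "n = num i" by blast
  have "empty_in M m \<or> (\<exists>k\<in>M. succ_in M k m)" if "m \<in> M" "m = n \<or> m \<in> elts n" for m
  proof -
    obtain j where j: "m = num j" using \<open>m = n \<or> m \<in> elts n\<close> i by (auto simp: elts_num)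
    show ?thesis
    proof (cases j)
      case 0
      then show ?thesis using j empty_in_iff[OF assms(1) that(1)] by simp
    next
      case (Suc k)
      then have "m = suc (num k)" using j by simp
      moreover from this have "num k \<in> M" using sub[OF that(1)] by simp
      ultimately show ?thesis using succ_in_iff[OF assms(1) _ that(1)] by blast
    qed
  qed
  then show "nat_in M n"
    unfolding nat_in_def mem_iff_elts ord_in_iff[OF assms] using i by simp
qed

text \<open>The premises place all elements of the flat pair in \<open>M\<close>, so quantifiers
  relativised to the transitive class \<open>M\<close> see the whole pair. With the numerals,
  \<open>M\<close> is closed under \<open>shift\<close>.\<close>

lemma pair_in_iff:
  assumes M: "transitive_class M" "range num \<subseteq> M" and "a \<in> M" "b \<in> M" "p \<in> M"
    and "flat_left ` elts a \<subseteq> M" "flat_right ` elts b \<subseteq> M"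
  shows "pair_in M a b p \<longleftrightarrow> p = flat_pair a b"
proof -
  have sub: "elts y \<subseteq> M" if "y \<in> M" for y using M(1) that by (auto simp: transitive_class_def)
  have sh: "shift_in M x y \<longleftrightarrow> y = shift x" if "x \<in> M" "y \<in> M" for x y
    using that by (simp add: shift_in_def shift_def nat_in_iff M(1) succ_in_iff)
  have shM: "shift x \<in> M" if "x \<in> M" for x
    using that M(2) by (auto simp: shift_def suc_num simp del: num.simps)
  have ex: "(\<exists>z\<in>M. z \<in> elts x \<and> shift_in M z y) \<longleftrightarrow> y \<in> shift ` elts x" if "x \<in> M" "y \<in> M" for x y
    using sh that sub by blast
  have im: "shift ` elts x \<subseteq> M" if "x \<in> M" for x using shM sub[OF that] by blast
  have ext: "(\<forall>y\<in>M. y \<in> elts u \<longleftrightarrow> y \<in> elts w) \<longleftrightarrow> u = w"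
    if "elts u \<subseteq> M" "elts w \<subseteq> M" for u w
  proof
    assume *: "\<forall>y\<in>M. y \<in> elts u \<longleftrightarrow> y \<in> elts w"
    have "elts u = elts w"
    proof (rule set_eqI)
      fix y show "y \<in> elts u \<longleftrightarrow> y \<in> elts w" using * that by (cases "y \<in> M") auto
    qed
    then show "u = w" by (simp only: elts_inject)
  qed simp
  have l: "left_in M x u \<longleftrightarrow> u = flat_left x" if "x \<in> M" "u \<in> M" for x u
  proof -
    have "left_in M x u \<longleftrightarrow> (\<forall>y\<in>M. y \<in> elts u \<longleftrightarrow> y \<in> elts (flat_left x))"
      unfolding left_in_def mem_iff_elts elts_flat_left by (intro ball_cong refl) (simp only: ex that)
    moreover have "elts (flat_left x) \<subseteq> M"
      unfolding elts_flat_left using im that by blast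
    ultimately show ?thesis using ext sub[OF that(2)] by blast
  qed
  have r: "right_in M x u \<longleftrightarrow> u = flat_right x" if "x \<in> M" "u \<in> M" for x u
  proof -
    have "right_in M x u \<longleftrightarrow> (\<forall>y\<in>M. y \<in> elts u \<longleftrightarrow> y \<in> elts (flat_right x))"
      unfolding right_in_def mem_iff_elts elts_flat_right
      by (intro ball_cong refl) (simp only: ex that empty_in_iff[OF M(1)] insert_iff)
    moreover have "elts (flat_right x) \<subseteq> M"
      unfolding elts_flat_right using im that M(2) by blast
    ultimately show ?thesis using ext sub[OF that(2)] by blast
  qed
  have "(\<exists>x\<in>M. x \<in> elts a \<and> left_in M x u) \<longleftrightarrow> u \<in> flat_left ` elts a" if "u \<in> M" for u
    using l that sub assms(3) by blast
  moreover have "(\<exists>x\<in>M. x \<in> elts b \<and> right_in M x u) \<longleftrightarrow> u \<in> flat_right ` elts b" if "u \<in> M" for u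
    using r that sub assms(4) by blast
  ultimately have "pair_in M a b p \<longleftrightarrow> (\<forall>u\<in>M. u \<in> elts p \<longleftrightarrow> u \<in> elts (flat_pair a b))"
    unfolding pair_in_def mem_iff_elts elts_flat_pair by simp
  moreover have "elts (flat_pair a b) \<subseteq> M" unfolding elts_flat_pair using assms by blast
  ultimately show ?thesis using ext sub[OF assms(5)] by blast
qed

section \<open>Bijections coded in the stages\<close>

lemma Ord_range_num_subset:
  assumes "Ord x" "x \<notin> range num"
  shows "range num \<subseteq> elts x"
  using assms(1) Ord_omega
proof (cases rule: Ord_linear)
  case 1
  then show ?thesis using assms(2) by simp
next
  case 2
  then show ?thesis by simp
next
  case 3
  then show ?thesis using Ord_trans[OF assms(1) 3] by (metis elts_omega subsetI)
qed

text \<open>Both tagged sets are included in \<open>d\<close> itself if \<open>d\<close> is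
  infinite, and in the next numeral if \<open>d\<close> is a numeral; in either case the bound is
  still below \<open>m\<close>.\<close>

lemma flat_in_V_stage:
  assumes m: "Ord m" "range num \<subseteq> elts m" and d: "d \<in> elts m"
  shows "flat_left d \<in> V_stage m" "flat_right d \<in> V_stage m"
proof -
  have "\<exists>e\<in>elts m. insert (num 0) (shift ` elts d) \<subseteq> elts e"
  proof (cases "d \<in> range num")
    case True
    then obtain n where n: "d = num n" by auto
    have "insert (num 0) (shift ` elts d) \<subseteq> elts (num (Suc n))"
      unfolding n elts_num by (auto simp: shift_def suc_num simp del: num.simps)
    then show ?thesis using m(2) by blast
  next
    case False
    then have "range num \<subseteq> elts d"
      using Ord_range_num_subset Ord_in_Ord[OF m(1) d] by blast
    then have "insert (num 0) (shift ` elts d) \<subseteq> elts d"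
      by (auto simp: shift_def suc_num simp del: num.simps)
    then show ?thesis using d by blast
  qed
  then obtain e where e: "e \<in> elts m" "insert (num 0) (shift ` elts d) \<subseteq> V_stage e"
    using elts_subset_V_stage by blast
  then show "flat_left d \<in> V_stage m" "flat_right d \<in> V_stage m"
    unfolding flat_left_def flat_right_def by (auto intro: set_of_in_V_stage)
qed

text \<open>The larger ordinal \<open>m\<close> decides: if it is infinite, the elements of the pair
  lie in \<open>V_stage m\<close>; if it is finite, they lie in a finite stage. So flat pairing
  costs no rank at an infinite \<open>x\<close>.\<close>

lemma flat_pair_in_V_stage:
  assumes x: "Ord x" "range num \<subseteq> elts x" and ab: "a \<in> elts x" "b \<in> elts x"
  shows "flat_pair a b \<in> V_stage x"
proof -
  have o: "Ord a" "Ord b" using Ord_in_Ord[OF x(1)] ab by auto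
  obtain m where m: "m \<in> elts x" "elts a \<subseteq> elts m" "elts b \<subseteq> elts m"
    using o
  proof (cases rule: Ord_linear)
    case 1
    then show ?thesis using that[OF ab(2)] Ord_trans[OF o(2)] by blast
  next
    case 2
    then show ?thesis using that[OF ab(2)] by blast
  next
    case 3
    then show ?thesis using that[OF ab(1)] Ord_trans[OF o(1)] by blast
  qed
  have om: "Ord m" using Ord_in_Ord[OF x(1) m(1)] .
  have "\<exists>e\<in>elts x. elts (flat_pair a b) \<subseteq> V_stage e"
  proof (cases "m \<in> range num")
    case True
    then obtain n where n: "m = num n" by blast
    \<comment> \<open>For \<open>d\<close> below \<open>n\<close>, both tagged sets are included in
      the numeral \<open>n + 1\<close>, hence are members of the stage \<open>n + 2\<close>.\<close>
    have *: "flat_left d \<in> V_stage (num (n + 2))" "flat_right d \<in> V_stage (num (n + 2))"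
      if d: "d \<in> elts m" for d
    proof -
      obtain i where i: "d = num i" "i < n" using d n by (auto simp: elts_num)
      have "insert (num 0) (shift ` elts d) \<subseteq> elts (num (Suc n))"
        unfolding i elts_num using i(2) by (auto simp: shift_def suc_num simp del: num.simps)
      then have "insert (num 0) (shift ` elts d) \<subseteq> V_stage (num (Suc n))"
        using elts_subset_V_stage by blast
      moreover have "num (Suc n) \<in> elts (num (n + 2))"
        unfolding elts_num by (intro imageI) simp
      ultimately show "flat_left d \<in> V_stage (num (n + 2))" "flat_right d \<in> V_stage (num (n + 2))"
        unfolding flat_left_def flat_right_def by (blast intro: set_of_in_V_stage)+
    qed
    then show ?thesis unfolding elts_flat_pair using m x(2) by (intro bexI[of _ "num (n + 2)"]) blast+
  next
    case False
    then have "range num \<subseteq> elts m" by (rule Ord_range_num_subset[OF om])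
    then show ?thesis
      unfolding elts_flat_pair using m flat_in_V_stage[OF om] by (intro bexI[of _ m]) blast+
  qed
  then show ?thesis by (simp add: V_stage_iff)
qed

lemma transitive_class_V_stage: "transitive_class (V_stage x)"
  using V_stage_trans by (auto simp: transitive_class_def)

text \<open>The graph of \<open>g\<close> consists of flat pairs in \<open>V_stage x\<close>, so it
  is a member of any later stage.\<close>

lemma ex_bij_in_V_stage:
  assumes \<alpha>: "Ord \<alpha>" "x \<in> elts \<alpha>" and x: "range num \<subseteq> elts x" and y: "y \<in> elts x"
    and g: "bij_betw g (elts y) (elts x)"
  shows "\<exists>f\<in>V_stage \<alpha>. bij_in (V_stage \<alpha>) f y x"
proof -
  let ?M = "V_stage \<alpha>"
  define f where "f = set_of ((\<lambda>\<xi>. flat_pair \<xi> (g \<xi>)) ` elts y)"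
  have f: "elts f = (\<lambda>\<xi>. flat_pair \<xi> (g \<xi>)) ` elts y" by (simp add: f_def)
  have ox: "Ord x" using Ord_in_Ord[OF \<alpha>] .
  have yx: "elts y \<subseteq> elts x" using Ord_trans[OF ox y] by blast
  have gx: "g \<xi> \<in> elts x" if "\<xi> \<in> elts y" for \<xi> using g that by (auto simp: bij_betw_def)
  have sub: "elts x \<subseteq> elts \<alpha>" using Ord_trans[OF \<alpha>] by blast
  have \<alpha>M: "elts \<alpha> \<subseteq> ?M" by (rule elts_subset_V_stage)
  have xM: "elts x \<subseteq> ?M" using sub \<alpha>M by blast
  have pairs: "flat_pair \<xi> \<eta> \<in> V_stage x" if "\<xi> \<in> elts x" "\<eta> \<in> elts x" for \<xi> \<eta>
    using flat_pair_in_V_stage[OF ox x] that by blast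
  have fM: "f \<in> ?M" unfolding f_def
    by (rule set_of_in_V_stage[OF _ \<alpha>(2)]) (use pairs gx yx in blast)
  have VxM: "V_stage x \<subseteq> ?M" using V_stage_lesspoll(1)[OF \<alpha>(2)] .
  have pM: "p \<in> ?M" if "p \<in> elts f" for p using that fM V_stage_trans by blast
  have pr: "pair_in ?M \<xi> \<eta> p \<longleftrightarrow> p = flat_pair \<xi> \<eta>"
    if "\<xi> \<in> elts x" "\<eta> \<in> elts x" "p \<in> ?M" for \<xi> \<eta> p
  proof (rule pair_in_iff[OF transitive_class_V_stage])
    show "flat_left ` elts \<xi> \<subseteq> ?M" "flat_right ` elts \<eta> \<subseteq> ?M"
      using flat_in_V_stage[OF ox x] Ord_trans[OF ox] that VxM by blast+
  qed (use that sub \<alpha>M x in auto)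
  have app: "app_in ?M f \<xi> \<eta> \<longleftrightarrow> \<eta> = g \<xi>" if "\<xi> \<in> elts y" "\<eta> \<in> elts x" for \<xi> \<eta>
  proof -
    have "app_in ?M f \<xi> \<eta> \<longleftrightarrow> (\<exists>p\<in>elts f. p = flat_pair \<xi> \<eta>)"
      unfolding app_in_def mem_iff_elts using pr that yx pM by blast
    also have "\<dots> \<longleftrightarrow> \<eta> = g \<xi>"
      unfolding f using that by (auto simp: flat_pair_inject)
    finally show ?thesis .
  qed
  have "bij_in ?M f y x"
    unfolding bij_in_def mem_iff_elts
  proof (intro conjI ballI impI)
    fix p assume p: "p \<in> elts f"
    then obtain \<xi> where \<xi>: "\<xi> \<in> elts y" "p = flat_pair \<xi> (g \<xi>)" by (auto simp: f)
    then have "\<xi> \<in> ?M" "g \<xi> \<in> ?M" "\<xi> \<in> elts x" "g \<xi> \<in> elts x"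
      using gx yx sub \<alpha>M by blast+
    then show "\<exists>x'\<in>?M. \<exists>y'\<in>?M. x' \<in> elts y \<and> y' \<in> elts x \<and> pair_in ?M x' y' p"
      using pr pM[OF p] \<xi> by blast
  next
    fix \<xi> assume "\<xi> \<in> elts y"
    then show "\<exists>!\<eta>. \<eta> \<in> ?M \<and> \<eta> \<in> elts x \<and> app_in ?M f \<xi> \<eta>"
      using app gx xM by (intro ex1I[of _ "g \<xi>"]) auto
  next
    fix \<eta> assume \<eta>: "\<eta> \<in> elts x"
    then obtain \<xi> where \<xi>: "\<xi> \<in> elts y" "\<eta> = g \<xi>" using g by (auto simp: bij_betw_def)
    show "\<exists>!\<xi>. \<xi> \<in> ?M \<and> \<xi> \<in> elts y \<and> app_in ?M f \<xi> \<eta>"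
    proof (rule ex1I[of _ \<xi>])
      show "\<xi> \<in> ?M \<and> \<xi> \<in> elts y \<and> app_in ?M f \<xi> \<eta>" using \<xi> \<eta> app yx xM by auto
      fix \<zeta> assume \<zeta>: "\<zeta> \<in> ?M \<and> \<zeta> \<in> elts y \<and> app_in ?M f \<zeta> \<eta>"
      then have "g \<zeta> = g \<xi>" using app \<eta> \<xi> by metis
      then show "\<zeta> = \<xi>" using g \<xi>(1) \<zeta> by (meson bij_betw_def inj_on_def)
    qed
  qed
  then show ?thesis using fM by blast
qed

text \<open>Finite ordinals are cardinals by counting. If an infinite ordinal of the stage is not a
  cardinal, a bijection with a smaller ordinal is coded in the stage, which therefore knows
  this.\<close>

lemma cardinal_correct_V_stage:
  assumes "Ord \<alpha>" "omega \<in> elts \<alpha>"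
  shows "cardinal_correct (V_stage \<alpha>)"
  unfolding cardinal_correct_def
proof (intro ballI impI)
  fix x assume x: "x \<in> V_stage \<alpha>" "card_in (V_stage \<alpha>) x"
  have ox: "Ord x"
    using x ord_in_iff[OF transitive_class_V_stage] by (auto simp: card_in_def)
  have xa: "x \<in> elts \<alpha>" using Ord_in_V_stage assms(1) ox x(1) by blast
  have "\<not> elts y \<approx> elts x" if y: "y \<in> elts x" for y
  proof
    assume eq: "elts y \<approx> elts x"
    have yx: "elts y \<subset> elts x" using Ord_trans[OF ox y] y by auto
    show False
    proof (cases "x \<in> elts omega")
      case True
      then have "finite (elts x)" by (auto simp: elts_num)
      moreover from this have "finite (elts y)" using yx finite_subset by blast
      ultimately have "card (elts y) = card (elts x)" "card (elts y) < card (elts x)"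
        using eq eqpoll_iff_card psubset_card_mono[OF _ yx] by blast+
      then show False by simp
    next
      case False
      then have om: "range num \<subseteq> elts x"
        using Ord_range_num_subset[OF ox] by simp
      obtain g where "bij_betw g (elts y) (elts x)" using eq by (auto simp: eqpoll_def)
      then obtain f where "f \<in> V_stage \<alpha>" "bij_in (V_stage \<alpha>) f y x"
        using ex_bij_in_V_stage[OF assms(1) xa om y] by blast
      moreover have "y \<in> V_stage \<alpha>" using x(1) y V_stage_trans by blast
      ultimately show False using x(2) y by (auto simp: card_in_def mem_iff_elts)
    qed
  qed
  then show "Card x" using ox by (simp add: Card_def)
qed

declare num.simps [simp del]

section \<open>Formulas\<close>

definition Or :: "'s fm \<Rightarrow> 's fm \<Rightarrow> 's fm" where
  "Or \<phi> \<psi> = Neg (Conj (Neg \<phi>) (Neg \<psi>))"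

definition Imp :: "'s fm \<Rightarrow> 's fm \<Rightarrow> 's fm" where
  "Imp \<phi> \<psi> = Neg (Conj \<phi> (Neg \<psi>))"

definition Iff :: "'s fm \<Rightarrow> 's fm \<Rightarrow> 's fm" where
  "Iff \<phi> \<psi> = Conj (Imp \<phi> \<psi>) (Imp \<psi> \<phi>)"

definition All :: "nat \<Rightarrow> 's fm \<Rightarrow> 's fm" where
  "All x \<phi> = Neg (Ex x (Neg \<phi>))"

lemma sat_derived [simp]:
  "sat A e (Or \<phi> \<psi>) \<longleftrightarrow> sat A e \<phi> \<or> sat A e \<psi>"
  "sat A e (Imp \<phi> \<psi>) \<longleftrightarrow> (sat A e \<phi> \<longrightarrow> sat A e \<psi>)"
  "sat A e (Iff \<phi> \<psi>) \<longleftrightarrow> (sat A e \<phi> \<longleftrightarrow> sat A e \<psi>)"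
  "sat A e (All x \<phi>) \<longleftrightarrow> (\<forall>a\<in>Dom A. sat A (e(x := a)) \<phi>)"
  by (auto simp: Or_def Imp_def Iff_def All_def)

lemma fm_of_derived [simp]:
  "fm_of \<tau> (Or \<phi> \<psi>) \<longleftrightarrow> fm_of \<tau> \<phi> \<and> fm_of \<tau> \<psi>"
  "fm_of \<tau> (Imp \<phi> \<psi>) \<longleftrightarrow> fm_of \<tau> \<phi> \<and> fm_of \<tau> \<psi>"
  "fm_of \<tau> (Iff \<phi> \<psi>) \<longleftrightarrow> fm_of \<tau> \<phi> \<and> fm_of \<tau> \<psi>"
  "fm_of \<tau> (All x \<phi>) \<longleftrightarrow> fm_of \<tau> \<phi>"
  by (auto simp: Or_def Imp_def Iff_def All_def)

lemma first_order_derived [simp]: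
  "first_order (Or \<phi> \<psi>) \<longleftrightarrow> first_order \<phi> \<and> first_order \<psi>"
  "first_order (Imp \<phi> \<psi>) \<longleftrightarrow> first_order \<phi> \<and> first_order \<psi>"
  "first_order (Iff \<phi> \<psi>) \<longleftrightarrow> first_order \<phi> \<and> first_order \<psi>"
  "first_order (All x \<phi>) \<longleftrightarrow> first_order \<phi>"
  by (auto simp: Or_def Imp_def Iff_def All_def)

lemma fv_derived [simp]:
  "fv (Or \<phi> \<psi>) = fv \<phi> \<union> fv \<psi>"
  "fv (Imp \<phi> \<psi>) = fv \<phi> \<union> fv \<psi>"
  "fv (Iff \<phi> \<psi>) = fv \<phi> \<union> fv \<psi>"
  "fv (All x \<phi>) = fv \<phi> - {x}"
  by (auto simp: Or_def Imp_def Iff_def All_def)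

lemma Dom_mem_struct [simp]: "Dom (mem_struct M) = M"
  by (simp add: mem_struct_def)

section \<open>Being a cardinal as a first-order formula\<close>

text \<open>In the following formulas \<open>n\<close> bounds the free variables from above, and the variables
  from \<open>n\<close> on are used for quantification.\<close>

definition mem_f :: "nat \<Rightarrow> nat \<Rightarrow> unit fm" where
  "mem_f x y = Rel () [Var x, Var y]"

definition empty_f :: "nat \<Rightarrow> nat \<Rightarrow> unit fm" where
  "empty_f x n = Neg (Ex n (mem_f n x))"

definition succ_f :: "nat \<Rightarrow> nat \<Rightarrow> nat \<Rightarrow> unit fm" where
  "succ_f x y n = All n (Iff (mem_f n y) (Or (mem_f n x) (Eq (Var n) (Var x))))"

definition trans_f :: "nat \<Rightarrow> nat \<Rightarrow> unit fm" where
  "trans_f x n = All n (All (n + 1) (Imp (Conj (mem_f n x) (mem_f (n + 1) n)) (mem_f (n + 1) x)))"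

definition ord_f :: "nat \<Rightarrow> nat \<Rightarrow> unit fm" where
  "ord_f x n = Conj (trans_f x n) (All n (Imp (mem_f n x) (trans_f n (n + 1))))"

definition nat_f :: "nat \<Rightarrow> nat \<Rightarrow> unit fm" where
  "nat_f x n = Conj (ord_f x n) (All n (Imp (Or (Eq (Var n) (Var x)) (mem_f n x))
     (Or (empty_f n (n + 1)) (Ex (n + 1) (succ_f (n + 1) n (n + 2))))))"

definition shift_f :: "nat \<Rightarrow> nat \<Rightarrow> nat \<Rightarrow> unit fm" where
  "shift_f x y n = Or (Conj (nat_f x n) (succ_f x y n)) (Conj (Neg (nat_f x n)) (Eq (Var y) (Var x)))"

definition shifted_f :: "nat \<Rightarrow> nat \<Rightarrow> nat \<Rightarrow> unit fm" where
  "shifted_f x y n = Ex n (Conj (mem_f n x) (shift_f n y (n + 1)))"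

definition left_f :: "nat \<Rightarrow> nat \<Rightarrow> nat \<Rightarrow> unit fm" where
  "left_f x u n = All n (Iff (mem_f n u) (shifted_f x n (n + 1)))"

definition right_f :: "nat \<Rightarrow> nat \<Rightarrow> nat \<Rightarrow> unit fm" where
  "right_f x u n = All n (Iff (mem_f n u) (Or (empty_f n (n + 1)) (shifted_f x n (n + 1))))"

definition pair_f :: "nat \<Rightarrow> nat \<Rightarrow> nat \<Rightarrow> nat \<Rightarrow> unit fm" where
  "pair_f a b p n = All n (Iff (mem_f n p)
     (Or (Ex (n + 1) (Conj (mem_f (n + 1) a) (left_f (n + 1) n (n + 2))))
         (Ex (n + 1) (Conj (mem_f (n + 1) b) (right_f (n + 1) n (n + 2))))))"

definition app_f :: "nat \<Rightarrow> nat \<Rightarrow> nat \<Rightarrow> nat \<Rightarrow> unit fm" where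
  "app_f f x y n = Ex n (Conj (mem_f n f) (pair_f x y n (n + 1)))"

definition bij_f :: "nat \<Rightarrow> nat \<Rightarrow> nat \<Rightarrow> nat \<Rightarrow> unit fm" where
  "bij_f f a b n = Conj
     (All n (Imp (mem_f n f) (Ex (n + 1) (Ex (n + 2)
       (Conj (mem_f (n + 1) a) (Conj (mem_f (n + 2) b) (pair_f (n + 1) (n + 2) n (n + 3))))))))
     (Conj
       (All n (Imp (mem_f n a) (Ex (n + 1) (Conj (Conj (mem_f (n + 1) b) (app_f f n (n + 1) (n + 3)))
         (All (n + 2) (Imp (Conj (mem_f (n + 2) b) (app_f f n (n + 2) (n + 3)))
           (Eq (Var (n + 2)) (Var (n + 1)))))))))
       (All n (Imp (mem_f n b) (Ex (n + 1) (Conj (Conj (mem_f (n + 1) a) (app_f f (n + 1) n (n + 3)))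
         (All (n + 2) (Imp (Conj (mem_f (n + 2) a) (app_f f (n + 2) n (n + 3)))
           (Eq (Var (n + 2)) (Var (n + 1))))))))))"

definition card_f :: "nat \<Rightarrow> nat \<Rightarrow> unit fm" where
  "card_f x n = Conj (ord_f x n)
     (Neg (Ex n (Conj (mem_f n x) (Ex (n + 1) (bij_f (n + 1) n x (n + 2))))))"

context
  fixes M :: "'v::zfc set"
begin

lemma sat_mem_f: "sat (mem_struct M) e (mem_f x y) \<longleftrightarrow> e x \<^bold>\<in> e y"
  by (simp add: mem_f_def mem_struct_def)

lemma sat_empty_f: "x < n \<Longrightarrow> sat (mem_struct M) e (empty_f x n) \<longleftrightarrow> empty_in M (e x)"
  by (simp add: empty_f_def empty_in_def sat_mem_f)

lemma sat_succ_f: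
  "x < n \<Longrightarrow> y < n \<Longrightarrow> sat (mem_struct M) e (succ_f x y n) \<longleftrightarrow> succ_in M (e x) (e y)"
  by (simp add: succ_f_def succ_in_def sat_mem_f)

lemma sat_trans_f: "x < n \<Longrightarrow> sat (mem_struct M) e (trans_f x n) \<longleftrightarrow> trans_in M (e x)"
  by (simp add: trans_f_def trans_in_def sat_mem_f)

lemma sat_ord_f: "x < n \<Longrightarrow> sat (mem_struct M) e (ord_f x n) \<longleftrightarrow> ord_in M (e x)"
  by (simp add: ord_f_def ord_in_def sat_mem_f sat_trans_f)

lemma sat_nat_f: "x < n \<Longrightarrow> sat (mem_struct M) e (nat_f x n) \<longleftrightarrow> nat_in M (e x)"
  by (simp add: nat_f_def nat_in_def sat_mem_f sat_ord_f sat_empty_f sat_succ_f)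

lemma sat_shift_f:
  "x < n \<Longrightarrow> y < n \<Longrightarrow> sat (mem_struct M) e (shift_f x y n) \<longleftrightarrow> shift_in M (e x) (e y)"
  by (simp add: shift_f_def shift_in_def sat_nat_f sat_succ_f)

lemma sat_shifted_f:
  "x < n \<Longrightarrow> y < n \<Longrightarrow> sat (mem_struct M) e (shifted_f x y n) \<longleftrightarrow>
     (\<exists>z\<in>M. z \<^bold>\<in> e x \<and> shift_in M z (e y))"
  by (simp add: shifted_f_def sat_mem_f sat_shift_f)

lemma sat_left_f:
  "x < n \<Longrightarrow> u < n \<Longrightarrow> sat (mem_struct M) e (left_f x u n) \<longleftrightarrow> left_in M (e x) (e u)"
  by (simp add: left_f_def left_in_def sat_mem_f sat_shifted_f)

lemma sat_right_f:
  "x < n \<Longrightarrow> u < n \<Longrightarrow> sat (mem_struct M) e (right_f x u n) \<longleftrightarrow> right_in M (e x) (e u)"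
  by (simp add: right_f_def right_in_def sat_mem_f sat_empty_f sat_shifted_f)

lemma sat_pair_f:
  "a < n \<Longrightarrow> b < n \<Longrightarrow> p < n \<Longrightarrow>
     sat (mem_struct M) e (pair_f a b p n) \<longleftrightarrow> pair_in M (e a) (e b) (e p)"
  by (simp add: pair_f_def pair_in_def sat_mem_f sat_left_f sat_right_f)

lemma sat_app_f:
  "f < n \<Longrightarrow> x < n \<Longrightarrow> y < n \<Longrightarrow>
     sat (mem_struct M) e (app_f f x y n) \<longleftrightarrow> app_in M (e f) (e x) (e y)"
  by (simp add: app_f_def app_in_def sat_mem_f sat_pair_f)

lemma sat_bij_f:
  assumes "f < n" "a < n" "b < n"
  shows "sat (mem_struct M) e (bij_f f a b n) \<longleftrightarrow> bij_in M (e f) (e a) (e b)"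
proof -
  \<comment> \<open>The formula has no unique existence quantifier and spells it out as existence
    and uniqueness over \<open>M\<close>.\<close>
  have ex1: "(\<exists>!y. y \<in> M \<and> P y \<and> Q y) \<longleftrightarrow>
      (\<exists>y\<in>M. P y \<and> Q y \<and> (\<forall>z\<in>M. P z \<and> Q z \<longrightarrow> z = y))" for P Q by blast
  show ?thesis
    using assms by (simp add: bij_f_def bij_in_def sat_mem_f sat_pair_f sat_app_f ex1)
qed

lemma sat_card_f: "x < n \<Longrightarrow> sat (mem_struct M) e (card_f x n) \<longleftrightarrow> card_in M (e x)"
  by (simp add: card_f_def card_in_def sat_mem_f sat_ord_f sat_bij_f)

end

lemmas set_fm_defs = mem_f_def empty_f_def succ_f_def trans_f_def ord_f_def nat_f_def shift_f_def
  shifted_f_def left_f_def right_f_def pair_f_def app_f_def bij_f_def card_f_def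

lemma card_f_set_lang: "fm_of set_lang (card_f x n)" "first_order (card_f x n)"
  by (simp_all add: set_fm_defs set_lang_def)

instance trm :: (countable) countable by countable_datatype
instance fm :: (countable) countable by countable_datatype

text \<open>There are only countably many formulas over \<open>unit\<close>, so numerals can code
  them; these lie in every \<open>V_stage (t n)\<close>.\<close>

definition code :: "unit fm \<Rightarrow> 'v::zfc" where
  "code \<psi> = num (to_nat \<psi>)"

lemma code_inject [simp]: "code \<phi> = code \<psi> \<longleftrightarrow> \<phi> = \<psi>"
  by (simp add: code_def)

section \<open>A sentence with the Haertig quantifier\<close>

text \<open>
  The intended meaning of the symbols is given by \<open>tower_struct\<close> below, whose domain is \<open>V_stage \<theta>\<close>
  for the supremum \<open>\<theta>\<close> of cardinals \<open>t 0 < t 1 < \<dots>\<close>. \<open>Rank_r z x\<close> says that the rank of \<open>z\<close> is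
  smaller than that of \<open>x\<close>, \<open>Sat_r v c a\<close> that \<open>(v, \<in>)\<close> satisfies the formula coded by \<open>c\<close> under
  the assignment \<open>a\<close>, \<open>Stage_r v\<close> that \<open>v\<close> is some \<open>V_stage \<alpha>\<close> with \<open>\<omega> < \<alpha> < \<theta>\<close>. Making satisfaction a
  relation of the structure turns elementarity into a property preserved by extensions of models of
  a single sentence.
\<close>

abbreviation get_t :: "'v::zfc trm \<Rightarrow> 'v trm \<Rightarrow> 'v trm" where
  "get_t a n \<equiv> App (num 0) [a, n]"
abbreviation upd_t :: "'v::zfc trm \<Rightarrow> 'v trm \<Rightarrow> 'v trm \<Rightarrow> 'v trm" where
  "upd_t a n x \<equiv> App (num 1) [a, n, x]"
abbreviation next_t :: "'v::zfc trm \<Rightarrow> 'v trm" where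
  "next_t x \<equiv> App (num 2) [x]"
abbreviation size_t :: "'v::zfc trm \<Rightarrow> 'v trm" where
  "size_t x \<equiv> App (num 3) [x]"
abbreviation enum_t :: "'v::zfc trm \<Rightarrow> 'v trm \<Rightarrow> 'v trm" where
  "enum_t x z \<equiv> App (num 4) [x, z]"
abbreviation base_t :: "'v::zfc trm" where
  "base_t \<equiv> App (num 5) []"
abbreviation card_t :: "'v::zfc trm" where
  "card_t \<equiv> App (num 6) []"
abbreviation zero_t :: "'v::zfc trm" where
  "zero_t \<equiv> App (num 7) []"

abbreviation Mem_r :: "'v::zfc trm \<Rightarrow> 'v trm \<Rightarrow> 'v fm" where
  "Mem_r x y \<equiv> Rel (num 0) [x, y]"
abbreviation Rank_r :: "'v::zfc trm \<Rightarrow> 'v trm \<Rightarrow> 'v fm" where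
  "Rank_r x y \<equiv> Rel (num 1) [x, y]"
abbreviation Tower_r :: "'v::zfc trm \<Rightarrow> 'v fm" where
  "Tower_r x \<equiv> Rel (num 2) [x]"
abbreviation Stage_r :: "'v::zfc trm \<Rightarrow> 'v fm" where
  "Stage_r x \<equiv> Rel (num 3) [x]"
abbreviation Sat_r :: "'v::zfc trm \<Rightarrow> 'v trm \<Rightarrow> 'v trm \<Rightarrow> 'v fm" where
  "Sat_r v c a \<equiv> Rel (num 4) [v, c, a]"
abbreviation IsEq_r :: "'v::zfc trm \<Rightarrow> 'v trm \<Rightarrow> 'v trm \<Rightarrow> 'v fm" where
  "IsEq_r c n m \<equiv> Rel (num 5) [c, n, m]"
abbreviation IsMem_r :: "'v::zfc trm \<Rightarrow> 'v trm \<Rightarrow> 'v trm \<Rightarrow> 'v fm" where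
  "IsMem_r c n m \<equiv> Rel (num 6) [c, n, m]"
abbreviation IsNeg_r :: "'v::zfc trm \<Rightarrow> 'v trm \<Rightarrow> 'v fm" where
  "IsNeg_r c d \<equiv> Rel (num 7) [c, d]"
abbreviation IsConj_r :: "'v::zfc trm \<Rightarrow> 'v trm \<Rightarrow> 'v trm \<Rightarrow> 'v fm" where
  "IsConj_r c d d' \<equiv> Rel (num 8) [c, d, d']"
abbreviation IsEx_r :: "'v::zfc trm \<Rightarrow> 'v trm \<Rightarrow> 'v trm \<Rightarrow> 'v fm" where
  "IsEx_r c n d \<equiv> Rel (num 9) [c, n, d]"

definition tower_lang :: "'v::zfc lang" where
  "tower_lang = \<lparr>Funs = num ` {..<8}, Rels = num ` {..<10},
     fun_ar = (\<lambda>s. [2, 3, 1, 1, 2, 0, 0, 0] ! the_inv num s),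
     rel_ar = (\<lambda>s. [2, 2, 1, 1, 3, 3, 3, 2, 3, 3] ! the_inv num s)\<rparr>"

section \<open>The axioms\<close>

definition ax_ext :: "'v::zfc fm" where
  "ax_ext = All 0 (All 1 (Imp (All 2 (Iff (Mem_r (Var 2) (Var 0)) (Mem_r (Var 2) (Var 1))))
     (Eq (Var 0) (Var 1))))"

definition ax_rank_subset :: "'v::zfc fm" where
  "ax_rank_subset = All 0 (All 1 (Imp (Mem_r (Var 1) (Var 0))
     (All 2 (Imp (Rank_r (Var 2) (Var 1)) (Rank_r (Var 2) (Var 0))))))"

text \<open>With the inclusion of \<open>ax_rank_subset\<close>, this makes cardinalities increase
  strictly along membership. The quantifier is evaluated with true equipollence in every
  model.\<close>

definition ax_rank_size :: "'v::zfc fm" where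
  "ax_rank_size = All 0 (All 1 (Imp (Mem_r (Var 1) (Var 0))
     (Neg (Hartig 2 2 (Rank_r (Var 2) (Var 1)) (Rank_r (Var 2) (Var 0))))))"

text \<open>One half of the recursion for \<open>V_stage\<close>; it bounds the ranks of the
  collapsed elements from above.\<close>

definition ax_rank :: "'v::zfc fm" where
  "ax_rank = All 0 (All 1 (Imp (Rank_r (Var 1) (Var 0))
     (Ex 2 (Conj (Mem_r (Var 2) (Var 0))
       (All 3 (Imp (Mem_r (Var 3) (Var 1)) (Rank_r (Var 3) (Var 2))))))))"

definition ax_cofinal :: "'v::zfc fm" where
  "ax_cofinal = All 0 (Ex 1 (Conj (Tower_r (Var 1)) (Rank_r (Var 0) (Var 1))))"

text \<open>Descending through this axiom must end at the base in a well-founded model, which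
  excludes new members of the tower.\<close>

definition ax_tower :: "'v::zfc fm" where
  "ax_tower = All 0 (Imp (Tower_r (Var 0)) (Or (Eq (Var 0) base_t)
     (Ex 1 (Conj (Mem_r (Var 1) (Var 0)) (Conj (Tower_r (Var 1)) (Eq (Var 0) (next_t (Var 1))))))))"

text \<open>Together with \<open>ax_tower_elem_trans\<close>, this makes the members of the tower
  ordinals of the model.\<close>

definition ax_tower_trans :: "'v::zfc fm" where
  "ax_tower_trans = All 0 (Imp (Tower_r (Var 0)) (All 1 (Imp (Mem_r (Var 1) (Var 0))
     (All 2 (Imp (Mem_r (Var 2) (Var 1)) (Mem_r (Var 2) (Var 0)))))))"

definition ax_tower_elem_trans :: "'v::zfc fm" where
  "ax_tower_elem_trans = All 0 (Imp (Tower_r (Var 0)) (All 1 (Imp (Mem_r (Var 1) (Var 0))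
     (All 2 (Imp (Mem_r (Var 2) (Var 1)) (All 3 (Imp (Mem_r (Var 3) (Var 2)) (Mem_r (Var 3) (Var 1)))))))))"

definition ax_enum :: "'v::zfc fm" where
  "ax_enum = All 0 (All 1 (Imp (Mem_r (Var 1) (Var 0))
     (Ex 2 (Conj (Mem_r (Var 2) (size_t (Var 0))) (Eq (Var 1) (enum_t (Var 0) (Var 2)))))))"

definition ax_stage_trans :: "'v::zfc fm" where
  "ax_stage_trans = All 0 (Imp (Stage_r (Var 0)) (All 1 (Imp (Mem_r (Var 1) (Var 0))
     (All 2 (Imp (Mem_r (Var 2) (Var 1)) (Mem_r (Var 2) (Var 0)))))))"

text \<open>Cardinal correctness of the stages. Variable 0 is the free variable of the formula coded
  by \<open>card_t\<close>; the rest of the assignment is arbitrary.\<close>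

definition ax_stage_card :: "'v::zfc fm" where
  "ax_stage_card = All 0 (Imp (Stage_r (Var 0)) (All 1 (Imp (Mem_r (Var 1) (Var 0))
     (All 2 (Imp (Sat_r (Var 0) card_t (upd_t (Var 2) zero_t (Var 1)))
       (All 3 (Imp (Mem_r (Var 3) (Var 1))
         (Neg (Hartig 4 4 (Mem_r (Var 4) (Var 3)) (Mem_r (Var 4) (Var 1)))))))))))"

definition ax_get_same :: "'v::zfc fm" where
  "ax_get_same = All 0 (All 1 (All 2 (Eq (get_t (upd_t (Var 0) (Var 1) (Var 2)) (Var 1)) (Var 2))))"

definition ax_get_other :: "'v::zfc fm" where
  "ax_get_other = All 0 (All 1 (All 2 (All 3 (Imp (Neg (Eq (Var 3) (Var 1)))
     (Eq (get_t (upd_t (Var 0) (Var 1) (Var 2)) (Var 3)) (get_t (Var 0) (Var 3)))))))"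

text \<open>The first of Tarski's clauses. They range over all elements of a model, but are applied
  at genuine codes, where a substructure determines the syntactic relations.\<close>

definition ax_sat_eq :: "'v::zfc fm" where
  "ax_sat_eq = All 0 (All 1 (All 2 (Imp (IsEq_r (Var 0) (Var 1) (Var 2))
     (All 3 (All 4 (Iff (Sat_r (Var 3) (Var 0) (Var 4))
       (Eq (get_t (Var 4) (Var 1)) (get_t (Var 4) (Var 2)))))))))"

definition ax_sat_mem :: "'v::zfc fm" where
  "ax_sat_mem = All 0 (All 1 (All 2 (Imp (IsMem_r (Var 0) (Var 1) (Var 2))
     (All 3 (All 4 (Iff (Sat_r (Var 3) (Var 0) (Var 4))
       (Mem_r (get_t (Var 4) (Var 1)) (get_t (Var 4) (Var 2)))))))))"

definition ax_sat_neg :: "'v::zfc fm" where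
  "ax_sat_neg = All 0 (All 1 (Imp (IsNeg_r (Var 0) (Var 1))
     (All 3 (All 4 (Iff (Sat_r (Var 3) (Var 0) (Var 4)) (Neg (Sat_r (Var 3) (Var 1) (Var 4))))))))"

definition ax_sat_conj :: "'v::zfc fm" where
  "ax_sat_conj = All 0 (All 1 (All 2 (Imp (IsConj_r (Var 0) (Var 1) (Var 2))
     (All 3 (All 4 (Iff (Sat_r (Var 3) (Var 0) (Var 4))
       (Conj (Sat_r (Var 3) (Var 1) (Var 4)) (Sat_r (Var 3) (Var 2) (Var 4)))))))))"

definition ax_sat_ex :: "'v::zfc fm" where
  "ax_sat_ex = All 0 (All 1 (All 2 (Imp (IsEx_r (Var 0) (Var 1) (Var 2))
     (All 3 (All 4 (Iff (Sat_r (Var 3) (Var 0) (Var 4))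
       (Ex 5 (Conj (Mem_r (Var 5) (Var 3))
         (Sat_r (Var 3) (Var 2) (upd_t (Var 4) (Var 1) (Var 5)))))))))))"

definition tower_axioms :: "'v::zfc fm list" where
  "tower_axioms = [ax_ext, ax_rank_subset, ax_rank_size, ax_rank, ax_cofinal, ax_tower,
     ax_tower_trans, ax_tower_elem_trans, ax_enum, ax_stage_trans, ax_stage_card, ax_get_same,
     ax_get_other, ax_sat_eq, ax_sat_mem, ax_sat_neg, ax_sat_conj, ax_sat_ex]"

text \<open>The fold needs some true base formula; \<open>ax_ext\<close> is repeated for
  that.\<close>

definition tower_sentence :: "'v::zfc fm" where
  "tower_sentence = foldr Conj tower_axioms ax_ext"

lemmas ax_defs = ax_ext_def ax_rank_subset_def ax_rank_size_def ax_rank_def ax_cofinal_def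
  ax_tower_def ax_tower_trans_def ax_tower_elem_trans_def ax_enum_def ax_stage_trans_def
  ax_stage_card_def ax_get_same_def ax_get_other_def ax_sat_eq_def ax_sat_mem_def ax_sat_neg_def
  ax_sat_conj_def ax_sat_ex_def

lemma the_inv_num [simp]: "the_inv num (num n) = n"
  by (rule the_inv_f_f[OF inj_num])

lemma sat_tower_sentence: "sat A e tower_sentence \<longleftrightarrow> (\<forall>\<phi>\<in>set tower_axioms. sat A e \<phi>)"
  by (auto simp: tower_sentence_def tower_axioms_def)

lemma sentence_of_tower_sentence: "sentence_of tower_lang tower_sentence"
proof -
  have "sentence_of tower_lang \<phi>" if "\<phi> \<in> set tower_axioms" for \<phi> :: "'a fm"
    using that unfolding tower_axioms_def
    by (auto simp: sentence_of_def ax_defs tower_lang_def)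
  then show ?thesis
    by (simp add: tower_sentence_def tower_axioms_def sentence_of_def)
qed

section \<open>The structure to be extended\<close>

text \<open>An assignment of values to keys is a set of pairs; \<open>num 0\<close> is the default value.\<close>

definition get :: "'v::zfc \<Rightarrow> 'v \<Rightarrow> 'v" where
  "get a n = (if \<exists>!y. kpair n y \<in> elts a then THE y. kpair n y \<in> elts a else num 0)"

definition upd :: "'v::zfc \<Rightarrow> 'v \<Rightarrow> 'v \<Rightarrow> 'v" where
  "upd a n x = set_of (insert (kpair n x) {p \<in> elts a. \<forall>y. p \<noteq> kpair n y})"

text \<open>
  For an ordinal \<open>x\<close> that is not a cardinal, \<open>enumeration x\<close> lists the elements of \<open>x\<close> along a smaller
  ordinal. An embedding preserving this fixes \<open>x\<close> if it fixes the elements of \<open>x\<close>; hence the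
  critical point is a cardinal.
\<close>

definition size_of :: "'v::zfc \<Rightarrow> 'v" where
  "size_of x = (if \<exists>\<beta>\<in>elts x. elts \<beta> \<approx> elts x then SOME \<beta>. \<beta> \<in> elts x \<and> elts \<beta> \<approx> elts x else x)"

definition enumeration :: "'v::zfc \<Rightarrow> 'v \<Rightarrow> 'v" where
  "enumeration x z = (if z \<in> elts (size_of x)
     then (SOME g. bij_betw g (elts (size_of x)) (elts x)) z else num 0)"

lemma elts_upd: "elts (upd a n x) = insert (kpair n x) {p \<in> elts a. \<forall>y. p \<noteq> kpair n y}"
proof -
  have "small {p \<in> elts a. \<forall>y. p \<noteq> kpair n y}"
    by (rule small_subset[OF small_elts[of a]]) auto
  then show ?thesis by (simp add: upd_def)
qed

lemma get_upd_same: "get (upd a n x) n = x"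
  by (auto simp: get_def elts_upd)

lemma get_upd_other: "m \<noteq> n \<Longrightarrow> get (upd a n x) m = get a m"
  by (auto simp: get_def elts_upd)

text \<open>This matches the update of assignments in the quantifier clause of
  \<open>sat\<close>.\<close>

lemma get_upd: "(\<lambda>i. get (upd a (num n) x) (num i)) = (\<lambda>i. get a (num i))(n := x)"
  by (auto simp: get_upd_same get_upd_other)

lemma get_eqI:
  assumes "kpair n y \<in> elts a" "\<And>z. kpair n z \<in> elts a \<Longrightarrow> z = y"
  shows "get a n = y"
proof -
  have "\<exists>!y. kpair n y \<in> elts a" using assms by blast
  moreover have "(THE y. kpair n y \<in> elts a) = y" using assms by (rule the_equality)
  ultimately show ?thesis by (simp add: get_def)
qed

lemma get_cases: "get a n = num 0 \<or> kpair n (get a n) \<in> elts a"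
proof (cases "\<exists>!y. kpair n y \<in> elts a")
  case True
  then show ?thesis using theI'[OF True] by (simp add: get_def)
qed (simp add: get_def)

lemma size_of_smaller:
  assumes "\<exists>\<beta>\<in>elts x. elts \<beta> \<approx> elts x"
  shows "size_of x \<in> elts x" "elts (size_of x) \<approx> elts x"
proof -
  have "\<exists>\<beta>. \<beta> \<in> elts x \<and> elts \<beta> \<approx> elts x" using assms by blast
  from someI_ex[OF this] show "size_of x \<in> elts x" "elts (size_of x) \<approx> elts x"
    using assms by (simp_all add: size_of_def)
qed

lemma size_of_cases: "size_of x = x \<or> size_of x \<in> elts x"
  using size_of_smaller(1)[of x] by (cases "\<exists>\<beta>\<in>elts x. elts \<beta> \<approx> elts x") (simp_all add: size_of_def)

lemma size_of_eqpoll: "elts (size_of x) \<approx> elts x"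
  using size_of_smaller(2)[of x] by (cases "\<exists>\<beta>\<in>elts x. elts \<beta> \<approx> elts x") (simp_all add: size_of_def)

lemma size_of_in: "Ord x \<Longrightarrow> \<not> Card x \<Longrightarrow> size_of x \<in> elts x"
  unfolding Card_def using size_of_smaller(1) by blast

lemma bij_enumeration: "bij_betw (enumeration x) (elts (size_of x)) (elts x)"
proof -
  have "\<exists>g. bij_betw g (elts (size_of x)) (elts x)" using size_of_eqpoll by (simp add: eqpoll_def)
  then have "bij_betw (SOME g. bij_betw g (elts (size_of x)) (elts x)) (elts (size_of x)) (elts x)"
    by (rule someI_ex)
  then show ?thesis by (rule bij_betw_cong[THEN iffD1, rotated]) (simp add: enumeration_def)
qed

section \<open>The tower of cardinals and its structure\<close>

locale tower =
  fixes t :: "nat \<Rightarrow> 'v::zfc"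
  assumes Card_t: "Card (t n)"
    and t_Suc: "t n \<in> elts (t (Suc n))"
    and omega_t: "omega \<in> elts (t 0)"
begin

text \<open>A limit ordinal of countable cofinality. The ordinals that the tower has to exceed enter
  in the final theorem.\<close>

definition \<theta> :: 'v where "\<theta> = set_of (\<Union>n. elts (t n))"

lemma elts_\<theta>: "elts \<theta> = (\<Union>n. elts (t n))"
proof -
  have "small (\<Union>x\<in>range t. elts x)" by (intro small_UN small_range_nat small_elts)
  then show ?thesis by (simp add: \<theta>_def)
qed

lemma Ord_t: "Ord (t n)"
  using Card_t by (simp add: Card_def)

lemma Ord_\<theta>: "Ord \<theta>"
proof -
  have "Ord (set_of (\<Union>x\<in>range t. elts x))" by (rule Ord_Union) (auto simp: Ord_t)
  then show ?thesis by (simp add: \<theta>_def)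
qed

lemma t_mono: "m \<le> n \<Longrightarrow> elts (t m) \<subseteq> elts (t n)"
proof (induction n)
  case (Suc n)
  then show ?case using Ord_trans[OF Ord_t t_Suc] by (cases "m = Suc n") (auto simp: le_Suc_eq)
qed auto

lemma t_less: "m < n \<Longrightarrow> t m \<in> elts (t n)"
  using t_Suc t_mono[of "Suc m" n] by auto

lemma inj_t: "inj t"
proof (rule injI)
  fix m n assume eq: "t m = t n"
  show "m = n" using t_less[of m n] t_less[of n m] eq by (cases m n rule: linorder_cases) auto
qed

lemma t_in_\<theta>: "t n \<in> elts \<theta>"
  using t_Suc elts_\<theta> by blast

lemma omega_in_t: "omega \<in> elts (t n)"
  using omega_t t_mono[of 0 n] by auto

lemma V_\<theta>_iff: "x \<in> V_stage \<theta> \<longleftrightarrow> (\<exists>n. x \<in> V_stage (t n))"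
  unfolding V_stage_iff[of x] elts_\<theta> by blast

lemma V_t_mono: "m \<le> n \<Longrightarrow> V_stage (t m) \<subseteq> V_stage (t n)"
  by (intro V_stage_mono t_mono)

lemma V_t_subset: "V_stage (t n) \<subseteq> V_stage \<theta>"
  using V_\<theta>_iff by blast

lemma set_of_V_t: "X \<subseteq> V_stage (t n) \<Longrightarrow> set_of X \<in> V_stage (t (Suc n))"
  using set_of_in_V_stage t_Suc by blast

lemma \<theta>_subset_V: "elts \<theta> \<subseteq> V_stage \<theta>"
  by (rule elts_subset_V_stage)

lemma t_in_V: "t n \<in> V_stage \<theta>"
  using t_in_\<theta> \<theta>_subset_V by blast

lemma num_in_V_t: "num i \<in> V_stage (t n)"
  using omega_in_t Ord_trans[OF Ord_t, of omega n] elts_subset_V_stage by (metis elts_omega rangeI subsetD)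

lemma num_in_V: "num i \<in> V_stage \<theta>"
  using num_in_V_t V_t_subset by blast

lemma kpair_in_V_t:
  assumes "x \<in> V_stage (t n)" "y \<in> V_stage (t n)"
  shows "kpair x y \<in> V_stage (t (Suc (Suc n)))"
  unfolding kpair_def by (intro set_of_V_t) (use assms in \<open>auto intro!: set_of_V_t\<close>)

lemma common_V_t:
  assumes "x \<in> V_stage \<theta>" "y \<in> V_stage \<theta>"
  obtains n where "x \<in> V_stage (t n)" "y \<in> V_stage (t n)"
proof -
  obtain i j where "x \<in> V_stage (t i)" "y \<in> V_stage (t j)" using assms V_\<theta>_iff by blast
  then show ?thesis using that[of "max i j"] V_t_mono[of i "max i j"] V_t_mono[of j "max i j"] by auto
qed

lemma upd_in_V:
  assumes "a \<in> V_stage \<theta>" "n \<in> V_stage \<theta>" "x \<in> V_stage \<theta>"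
  shows "upd a n x \<in> V_stage \<theta>"
proof -
  obtain k where "n \<in> V_stage (t k)" "x \<in> V_stage (t k)" using common_V_t[OF assms(2,3)] .
  then have "kpair n x \<in> V_stage \<theta>" using kpair_in_V_t V_t_subset by blast
  with assms(1) obtain m where m: "a \<in> V_stage (t m)" "kpair n x \<in> V_stage (t m)"
    by (rule common_V_t)
  then have "insert (kpair n x) {p \<in> elts a. \<forall>y. p \<noteq> kpair n y} \<subseteq> V_stage (t m)"
    using V_stage_trans by blast
  then show ?thesis unfolding upd_def using set_of_V_t V_t_subset by blast
qed

lemma get_in_V:
  assumes "a \<in> V_stage \<theta>"
  shows "get a n \<in> V_stage \<theta>"
  using get_cases[of a n]
proof
  assume "get a n = num 0"
  then show ?thesis using num_in_V by simp
next
  assume 2: "kpair n (get a n) \<in> elts a"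
  have "set_of {n, get a n} \<in> elts (kpair n (get a n))" by (simp add: kpair_def)
  moreover have "get a n \<in> elts (set_of {n, get a n})" by simp
  ultimately show ?thesis using 2 assms V_stage_trans by blast
qed

lemma size_of_in_V: "x \<in> V_stage \<theta> \<Longrightarrow> size_of x \<in> V_stage \<theta>"
  using size_of_cases[of x] V_stage_trans[of x] by auto

lemma enum_in_V:
  assumes "x \<in> V_stage \<theta>"
  shows "enumeration x z \<in> V_stage \<theta>"
proof (cases "z \<in> elts (size_of x)")
  case True
  then have "enumeration x z \<in> elts x" using bij_enumeration by (auto simp: bij_betw_def)
  then show ?thesis using assms V_stage_trans by blast
next
  case False
  then show ?thesis using num_in_V by (simp add: enumeration_def)
qed

text \<open>Off the tower, the value \<open>num 0\<close> merely keeps the function total on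
  \<open>V_stage \<theta>\<close>.\<close>

definition next_level :: "'v \<Rightarrow> 'v" where
  "next_level x = (if x \<in> range t then t (Suc (the_inv t x)) else num 0)"

lemma next_level_t [simp]: "next_level (t n) = t (Suc n)"
  by (simp add: next_level_def the_inv_f_f[OF inj_t])

lemma next_level_in_V: "next_level x \<in> V_stage \<theta>"
  using t_in_V num_in_V by (simp add: next_level_def)

definition is_stage :: "'v \<Rightarrow> bool" where
  "is_stage v \<longleftrightarrow> (\<exists>\<alpha>\<in>elts \<theta>. omega \<in> elts \<alpha> \<and> elts v = V_stage \<alpha>)"

text \<open>False unless \<open>c\<close> codes a formula, which is then unique.\<close>

definition Sat :: "'v \<Rightarrow> 'v \<Rightarrow> 'v \<Rightarrow> bool" where
  "Sat v c a \<longleftrightarrow> (\<exists>\<psi>. c = code \<psi> \<and> sat (mem_struct (elts v)) (\<lambda>i. get a (num i)) \<psi>)"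

text \<open>Symbols are numerals, so the interpretations are listed by index, in the order of the
  arities in \<open>tower_lang\<close>.\<close>

definition tower_struct :: "('v, 'v) struct" where
  "tower_struct = \<lparr>Dom = V_stage \<theta>,
     fun_int = (\<lambda>s xs. [get (xs ! 0) (xs ! 1), upd (xs ! 0) (xs ! 1) (xs ! 2), next_level (xs ! 0),
       size_of (xs ! 0), enumeration (xs ! 0) (xs ! 1), t 0, code (card_f 0 1), num 0] ! the_inv num s),
     rel_int = (\<lambda>s xs. [xs ! 0 \<in> elts (xs ! 1), xs ! 0 \<in> V_stage (xs ! 1), xs ! 0 \<in> range t,
       is_stage (xs ! 0), Sat (xs ! 0) (xs ! 1) (xs ! 2),
       \<exists>i j. xs ! 0 = code (Eq (Var i) (Var j)) \<and> xs ! 1 = num i \<and> xs ! 2 = num j,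
       \<exists>i j. xs ! 0 = code (mem_f i j) \<and> xs ! 1 = num i \<and> xs ! 2 = num j,
       \<exists>\<psi>. xs ! 0 = code (Neg \<psi>) \<and> xs ! 1 = code \<psi>,
       \<exists>\<psi> \<chi>. xs ! 0 = code (Conj \<psi> \<chi>) \<and> xs ! 1 = code \<psi> \<and> xs ! 2 = code \<chi>,
       \<exists>i \<psi>. xs ! 0 = code (Ex i \<psi>) \<and> xs ! 1 = num i \<and> xs ! 2 = code \<psi>] ! the_inv num s)\<rparr>"

lemma tower_struct_simps [simp]:
  "Dom tower_struct = V_stage \<theta>"
  "fun_int tower_struct (num 0) [a, n] = get a n"
  "fun_int tower_struct (num (Suc 0)) [a, n, x] = upd a n x"
  "fun_int tower_struct (num 2) [x] = next_level x"
  "fun_int tower_struct (num 3) [x] = size_of x"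
  "fun_int tower_struct (num 4) [x, z] = enumeration x z"
  "fun_int tower_struct (num 5) [] = t 0"
  "fun_int tower_struct (num 6) [] = code (card_f 0 1)"
  "fun_int tower_struct (num 7) [] = num 0"
  "rel_int tower_struct (num 0) [x, y] \<longleftrightarrow> x \<in> elts y"
  "rel_int tower_struct (num (Suc 0)) [x, y] \<longleftrightarrow> x \<in> V_stage y"
  "rel_int tower_struct (num 2) [x] \<longleftrightarrow> x \<in> range t"
  "rel_int tower_struct (num 3) [x] \<longleftrightarrow> is_stage x"
  "rel_int tower_struct (num 4) [v, c, a] \<longleftrightarrow> Sat v c a"
  "rel_int tower_struct (num 5) [c, n, m] \<longleftrightarrow>
     (\<exists>i j. c = code (Eq (Var i) (Var j)) \<and> n = num i \<and> m = num j)"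
  "rel_int tower_struct (num 6) [c, n, m] \<longleftrightarrow>
     (\<exists>i j. c = code (mem_f i j) \<and> n = num i \<and> m = num j)"
  "rel_int tower_struct (num 7) [c, d] \<longleftrightarrow> (\<exists>\<psi>. c = code (Neg \<psi>) \<and> d = code \<psi>)"
  "rel_int tower_struct (num 8) [c, d, d'] \<longleftrightarrow>
     (\<exists>\<psi> \<chi>. c = code (Conj \<psi> \<chi>) \<and> d = code \<psi> \<and> d' = code \<chi>)"
  "rel_int tower_struct (num 9) [c, n, d] \<longleftrightarrow>
     (\<exists>i \<psi>. c = code (Ex i \<psi>) \<and> n = num i \<and> d = code \<psi>)"
  by (simp_all add: tower_struct_def)

lemma code_in_V: "code \<psi> \<in> V_stage \<theta>"
  using num_in_V by (simp add: code_def)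

lemma structure_of_tower_struct: "structure_of tower_lang tower_struct"
proof -
  have "fun_int tower_struct f xs \<in> V_stage \<theta>"
    if f: "f \<in> Funs tower_lang" and xs: "xs \<in> lists (V_stage \<theta>)" "length xs = fun_ar tower_lang f"
    for f xs
  proof -
    obtain i where i: "f = num i" "i < 8" using f by (auto simp: tower_lang_def)
    have sub: "xs ! k \<in> V_stage \<theta>" if "k < length xs" for k
      using xs(1) that by auto
    have len: "length xs = [2, 3, 1, 1, 2, 0, 0, 0] ! i"
      using xs(2) by (simp add: tower_lang_def i)
    from i(2) consider "i = 0" | "i = 1" | "i = 2" | "i = 3" | "i = 4" | "i = 5" | "i = 6" | "i = 7"
      by linarith
    then show ?thesis
      by cases (use len in \<open>auto simp: tower_struct_def i sub
          intro!: get_in_V upd_in_V next_level_in_V size_of_in_V enum_in_V t_in_V code_in_V num_in_V\<close>)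
  qed
  then show ?thesis
    using t_in_V by (auto simp: structure_of_def)
qed

lemma Sat_code: "Sat v (code \<psi>) a \<longleftrightarrow> sat (mem_struct (elts v)) (\<lambda>i. get a (num i)) \<psi>"
  by (auto simp: Sat_def)

lemma V_stage_in_V_\<theta>:
  assumes "y \<in> V_stage \<theta>"
  shows "V_stage y \<subseteq> V_stage \<theta>"
  using assms V_stage_trans by (intro V_stage_subset) blast

lemma elts_in_V: "x \<in> V_stage \<theta> \<Longrightarrow> y \<in> elts x \<Longrightarrow> y \<in> V_stage \<theta>"
  using V_stage_trans .

text \<open>Two axioms carry mathematical content: \<open>ax_rank_size\<close> is Cantor's theorem
  for the stages, and \<open>ax_stage_card\<close> is the cardinal correctness of true
  stages.\<close>

lemma sat_tower_struct: "\<phi> \<in> set tower_axioms \<Longrightarrow> sat tower_struct e \<phi>"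
proof -
  have "sat tower_struct e ax_ext"
  proof -
    have "x = y" if "x \<in> V_stage \<theta>" "y \<in> V_stage \<theta>" "\<forall>z\<in>V_stage \<theta>. z \<in> elts x \<longleftrightarrow> z \<in> elts y" for x y
    proof -
      have "elts x = elts y" using that elts_in_V by blast
      then show ?thesis by (simp only: elts_inject)
    qed
    then show ?thesis by (auto simp: ax_ext_def)
  qed
  moreover have "sat tower_struct e ax_rank_subset"
    using V_stage_lesspoll(1) by (auto simp: ax_rank_subset_def)
  moreover have "sat tower_struct e ax_rank_size"
  proof -
    have "{z \<in> V_stage \<theta>. z \<in> V_stage x} = V_stage x" if "x \<in> V_stage \<theta>" for x
      using V_stage_in_V_\<theta>[OF that] by blast
    then show ?thesis using V_stage_lesspoll(2) by (auto simp: ax_rank_size_def)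
  qed
  moreover have "sat tower_struct e ax_rank"
  proof -
    have "\<exists>y\<in>V_stage \<theta>. y \<in> elts x \<and> (\<forall>w\<in>V_stage \<theta>. w \<in> elts z \<longrightarrow> w \<in> V_stage y)"
      if "x \<in> V_stage \<theta>" "z \<in> V_stage x" for x z
      using that elts_in_V unfolding V_stage_iff[of z x] by blast
    then show ?thesis by (simp add: ax_rank_def)
  qed
  moreover have "sat tower_struct e ax_cofinal"
  proof -
    have "\<exists>y\<in>V_stage \<theta>. y \<in> range t \<and> x \<in> V_stage y" if "x \<in> V_stage \<theta>" for x
      using that t_in_V unfolding V_\<theta>_iff[of x] by blast
    then show ?thesis by (simp add: ax_cofinal_def)
  qed
  moreover have "sat tower_struct e ax_tower"
  proof -
    have "t n = t 0 \<or> (\<exists>y\<in>V_stage \<theta>. y \<in> elts (t n) \<and> y \<in> range t \<and> t n = next_level y)" for n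
    proof (cases n)
      case (Suc m)
      then show ?thesis
        using t_Suc[of m] t_in_V[of m] next_level_t[of m] by (metis rangeI)
    qed simp
    then show ?thesis by (auto simp: ax_tower_def)
  qed
  moreover have "sat tower_struct e ax_tower_trans"
    using Ord_trans[OF Ord_t] by (auto simp: ax_tower_trans_def)
  moreover have "sat tower_struct e ax_tower_elem_trans"
    using Ord_trans[OF Ord_in_Ord[OF Ord_t]] by (auto simp: ax_tower_elem_trans_def)
  moreover have "sat tower_struct e ax_enum"
  proof -
    have "\<exists>z\<in>V_stage \<theta>. z \<in> elts (size_of x) \<and> y = enumeration x z"
      if "x \<in> V_stage \<theta>" "y \<in> elts x" for x y
      using bij_enumeration[of x] that elts_in_V[OF size_of_in_V] unfolding bij_betw_def by blast
    then show ?thesis by (auto simp: ax_enum_def)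
  qed
  moreover have "sat tower_struct e ax_stage_trans"
    using V_stage_trans by (auto simp: ax_stage_trans_def is_stage_def)
  moreover have "sat tower_struct e ax_stage_card"
  proof -
    have "\<not> {z \<in> V_stage \<theta>. z \<in> elts y} \<approx> {z \<in> V_stage \<theta>. z \<in> elts x}"
      if v: "is_stage v" "v \<in> V_stage \<theta>" and x: "x \<in> elts v" and y: "y \<in> elts x"
        and s: "Sat v (code (card_f 0 1)) (upd a (num 0) x)" for v x a y
    proof -
      obtain \<alpha> where \<alpha>: "\<alpha> \<in> elts \<theta>" "omega \<in> elts \<alpha>" "elts v = V_stage \<alpha>"
        using v(1) by (auto simp: is_stage_def)
      have "card_in (V_stage \<alpha>) x"
        \<comment> \<open>The updated assignment sends variable 0 to \<open>x\<close>, so the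
          formula speaks about \<open>x\<close>.\<close>
        using s by (simp add: Sat_code get_upd sat_card_f \<alpha>)
      then have "Card x"
        using cardinal_correct_V_stage[OF Ord_in_Ord[OF Ord_\<theta> \<alpha>(1)] \<alpha>(2)] x
        by (simp add: cardinal_correct_def \<alpha>)
      moreover have "{z \<in> V_stage \<theta>. z \<in> elts u} = elts u" if "u \<in> V_stage \<theta>" for u
        using that elts_in_V by blast
      moreover have "x \<in> V_stage \<theta>" "y \<in> V_stage \<theta>" using x y v(2) elts_in_V by blast+
      ultimately show ?thesis using y by (simp add: Card_def)
    qed
    then show ?thesis by (auto simp: ax_stage_card_def)
  qed
  moreover have "sat tower_struct e ax_get_same" "sat tower_struct e ax_get_other"
    by (auto simp: ax_get_same_def ax_get_other_def get_upd_same get_upd_other)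
  moreover have "sat tower_struct e ax_sat_eq"
    by (auto simp: ax_sat_eq_def Sat_code)
  moreover have "sat tower_struct e ax_sat_mem"
    by (auto simp: ax_sat_mem_def Sat_code sat_mem_f mem_iff_elts)
  moreover have "sat tower_struct e ax_sat_neg"
    by (auto simp: ax_sat_neg_def Sat_code)
  moreover have "sat tower_struct e ax_sat_conj"
    by (auto simp: ax_sat_conj_def Sat_code)
  moreover have "sat tower_struct e ax_sat_ex"
  proof -
    have "(\<exists>x\<in>elts v. P x) \<longleftrightarrow> (\<exists>x\<in>V_stage \<theta>. x \<in> elts v \<and> P x)" if "v \<in> V_stage \<theta>" for v P
      using elts_in_V[OF that] by blast
    then show ?thesis by (auto simp: ax_sat_ex_def Sat_code get_upd)
  qed
  ultimately show "\<phi> \<in> set tower_axioms \<Longrightarrow> sat tower_struct e \<phi>"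
    by (auto simp: tower_axioms_def)
qed

lemma tower_struct_models: "tower_struct \<Turnstile> tower_sentence"
  by (auto simp: models_def sat_tower_sentence sat_tower_struct)

end

section \<open>Collapsing an extension\<close>

lemma trm_of_set_lang: "trm_of set_lang x \<Longrightarrow> \<exists>i. x = Var i"
  by (cases x) (auto simp: set_lang_def)

section \<open>The extension and its axioms\<close>

locale tower_extension = tower t for t :: "nat \<Rightarrow> 'v::zfc" +
  fixes B :: "('v, 'v) struct"
  assumes B_structure: "structure_of tower_lang B"
    and B_models: "B \<Turnstile> tower_sentence"
    and B_extends: "substructure tower_lang tower_struct B"
    and B_large: "\<not> Dom B \<lesssim> V_stage \<theta>"
begin

abbreviation "D \<equiv> Dom B"
abbreviation "mem_B x y \<equiv> rel_int B (num 0) [x, y]"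
abbreviation "rank_B x y \<equiv> rel_int B (num (Suc 0)) [x, y]"
abbreviation "tower_B x \<equiv> rel_int B (num 2) [x]"
abbreviation "stage_B x \<equiv> rel_int B (num 3) [x]"
abbreviation "sat_B v c a \<equiv> rel_int B (num 4) [v, c, a]"
abbreviation "get_B a n \<equiv> fun_int B (num 0) [a, n]"
abbreviation "upd_B a n x \<equiv> fun_int B (num (Suc 0)) [a, n, x]"

lemma V_subset_D: "V_stage \<theta> \<subseteq> D"
  using B_extends by (simp add: substructure_def)

lemma small_D: "small D"
  using B_structure by (simp add: structure_of_def)

lemma fun_B_in_D:
  assumes "i < 8" "set xs \<subseteq> D" "length xs = [2, 3, 1, 1, 2, 0, 0, 0] ! i"
  shows "fun_int B (num i) xs \<in> D"
proof -
  have "num i \<in> Funs tower_lang" "xs \<in> lists D" "length xs = fun_ar tower_lang (num i)"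
    using assms by (auto simp: tower_lang_def)
  then show ?thesis using B_structure unfolding structure_of_def by blast
qed

lemma fun_B_eq:
  assumes "i < 8" "set xs \<subseteq> V_stage \<theta>" "length xs = [2, 3, 1, 1, 2, 0, 0, 0] ! i"
  shows "fun_int B (num i) xs = fun_int tower_struct (num i) xs"
proof -
  have "num i \<in> Funs tower_lang" "xs \<in> lists (Dom tower_struct)"
      "length xs = fun_ar tower_lang (num i)"
    using assms by (auto simp: tower_lang_def)
  then show ?thesis using B_extends unfolding substructure_def by metis
qed

lemma rel_B_iff:
  assumes "i < 10" "set xs \<subseteq> V_stage \<theta>" "length xs = [2, 2, 1, 1, 3, 3, 3, 2, 3, 3] ! i"
  shows "rel_int B (num i) xs \<longleftrightarrow> rel_int tower_struct (num i) xs"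
proof -
  have "num i \<in> Rels tower_lang" "xs \<in> lists (Dom tower_struct)"
      "length xs = rel_ar tower_lang (num i)"
    using assms by (auto simp: tower_lang_def)
  then show ?thesis using B_extends unfolding substructure_def by metis
qed

text \<open>A model satisfies the sentence under every assignment, and a constant one exists as the
  domain is nonempty. The axioms are closed, so one assignment is enough.\<close>

lemma B_axiom:
  assumes "\<phi> \<in> set tower_axioms"
  shows "\<exists>e. sat B e \<phi>"
proof -
  obtain d where "d \<in> D" using B_structure by (auto simp: structure_of_def)
  then have "sat B (\<lambda>_. d) tower_sentence" using B_models by (auto simp: models_def)
  then show ?thesis using assms by (auto simp: sat_tower_sentence)
qed

lemma B_axioms:
  "\<exists>e. sat B e ax_ext" "\<exists>e. sat B e ax_rank_subset" "\<exists>e. sat B e ax_rank_size"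
  "\<exists>e. sat B e ax_rank" "\<exists>e. sat B e ax_cofinal" "\<exists>e. sat B e ax_tower"
  "\<exists>e. sat B e ax_tower_trans" "\<exists>e. sat B e ax_tower_elem_trans" "\<exists>e. sat B e ax_enum"
  "\<exists>e. sat B e ax_stage_trans" "\<exists>e. sat B e ax_stage_card" "\<exists>e. sat B e ax_get_same"
  "\<exists>e. sat B e ax_get_other" "\<exists>e. sat B e ax_sat_eq" "\<exists>e. sat B e ax_sat_mem"
  "\<exists>e. sat B e ax_sat_neg" "\<exists>e. sat B e ax_sat_conj" "\<exists>e. sat B e ax_sat_ex"
  by (rule B_axiom, simp add: tower_axioms_def)+

lemma ext_B: "x \<in> D \<Longrightarrow> y \<in> D \<Longrightarrow> \<forall>z\<in>D. mem_B z x \<longleftrightarrow> mem_B z y \<Longrightarrow> x = y"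
  using B_axioms(1) by (simp add: ax_ext_def)

lemma rank_subset_B:
  "x \<in> D \<Longrightarrow> y \<in> D \<Longrightarrow> mem_B y x \<Longrightarrow> {z \<in> D. rank_B z y} \<subseteq> {z \<in> D. rank_B z x}"
  using B_axioms(2) by (auto simp: ax_rank_subset_def)

lemma rank_size_B:
  "x \<in> D \<Longrightarrow> y \<in> D \<Longrightarrow> mem_B y x \<Longrightarrow> \<not> {z \<in> D. rank_B z y} \<approx> {z \<in> D. rank_B z x}"
  using B_axioms(3) by (simp add: ax_rank_size_def)

lemma rank_B:
  "x \<in> D \<Longrightarrow> z \<in> D \<Longrightarrow> rank_B z x \<Longrightarrow>
     \<exists>y\<in>D. mem_B y x \<and> (\<forall>w\<in>D. mem_B w z \<longrightarrow> rank_B w y)"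
  using B_axioms(4) by (simp add: ax_rank_def)

lemma cofinal_B: "x \<in> D \<Longrightarrow> \<exists>y\<in>D. tower_B y \<and> rank_B x y"
  using B_axioms(5) by (simp add: ax_cofinal_def)

lemma tower_B_cases:
  "x \<in> D \<Longrightarrow> tower_B x \<Longrightarrow> x = fun_int B (num 5) [] \<or>
     (\<exists>y\<in>D. mem_B y x \<and> tower_B y \<and> x = fun_int B (num 2) [y])"
  using B_axioms(6) by (simp add: ax_tower_def)

lemma tower_trans_B:
  "x \<in> D \<Longrightarrow> tower_B x \<Longrightarrow> y \<in> D \<Longrightarrow> mem_B y x \<Longrightarrow> z \<in> D \<Longrightarrow> mem_B z y \<Longrightarrow> mem_B z x"
  using B_axioms(7) unfolding ax_tower_trans_def by (simp (no_asm_use)) blast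

lemma tower_elem_trans_B:
  "x \<in> D \<Longrightarrow> tower_B x \<Longrightarrow> y \<in> D \<Longrightarrow> mem_B y x \<Longrightarrow> z \<in> D \<Longrightarrow> mem_B z y \<Longrightarrow>
     w \<in> D \<Longrightarrow> mem_B w z \<Longrightarrow> mem_B w y"
  using B_axioms(8) unfolding ax_tower_elem_trans_def by (simp (no_asm_use)) blast

lemma enum_B:
  "x \<in> D \<Longrightarrow> y \<in> D \<Longrightarrow> mem_B y x \<Longrightarrow>
     \<exists>z\<in>D. mem_B z (fun_int B (num 3) [x]) \<and> y = fun_int B (num 4) [x, z]"
  using B_axioms(9) by (simp add: ax_enum_def)

lemma stage_trans_B:
  "v \<in> D \<Longrightarrow> stage_B v \<Longrightarrow> x \<in> D \<Longrightarrow> mem_B x v \<Longrightarrow> y \<in> D \<Longrightarrow> mem_B y x \<Longrightarrow> mem_B y v"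
  using B_axioms(10) unfolding ax_stage_trans_def by (simp (no_asm_use)) blast

lemma stage_card_B:
  "v \<in> D \<Longrightarrow> stage_B v \<Longrightarrow> x \<in> D \<Longrightarrow> mem_B x v \<Longrightarrow> a \<in> D \<Longrightarrow>
     sat_B v (fun_int B (num 6) []) (upd_B a (fun_int B (num 7) []) x) \<Longrightarrow> y \<in> D \<Longrightarrow> mem_B y x \<Longrightarrow>
     \<not> {z \<in> D. mem_B z y} \<approx> {z \<in> D. mem_B z x}"
  using B_axioms(11) unfolding ax_stage_card_def by (simp (no_asm_use)) blast

lemma get_upd_same_B: "a \<in> D \<Longrightarrow> n \<in> D \<Longrightarrow> x \<in> D \<Longrightarrow> get_B (upd_B a n x) n = x"
  using B_axioms(12) by (simp add: ax_get_same_def)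

lemma get_upd_other_B:
  "a \<in> D \<Longrightarrow> n \<in> D \<Longrightarrow> x \<in> D \<Longrightarrow> m \<in> D \<Longrightarrow> m \<noteq> n \<Longrightarrow> get_B (upd_B a n x) m = get_B a m"
  using B_axioms(13) by (simp add: ax_get_other_def)

lemma sat_eq_B:
  "c \<in> D \<Longrightarrow> n \<in> D \<Longrightarrow> m \<in> D \<Longrightarrow> rel_int B (num 5) [c, n, m] \<Longrightarrow> v \<in> D \<Longrightarrow> a \<in> D \<Longrightarrow>
     sat_B v c a \<longleftrightarrow> get_B a n = get_B a m"
  using B_axioms(14) by (simp add: ax_sat_eq_def)

lemma sat_mem_B:
  "c \<in> D \<Longrightarrow> n \<in> D \<Longrightarrow> m \<in> D \<Longrightarrow> rel_int B (num 6) [c, n, m] \<Longrightarrow> v \<in> D \<Longrightarrow> a \<in> D \<Longrightarrow>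
     sat_B v c a \<longleftrightarrow> mem_B (get_B a n) (get_B a m)"
  using B_axioms(15) by (simp add: ax_sat_mem_def)

lemma sat_neg_B:
  "c \<in> D \<Longrightarrow> d \<in> D \<Longrightarrow> rel_int B (num 7) [c, d] \<Longrightarrow> v \<in> D \<Longrightarrow> a \<in> D \<Longrightarrow>
     sat_B v c a \<longleftrightarrow> \<not> sat_B v d a"
  using B_axioms(16) by (simp add: ax_sat_neg_def)

lemma sat_conj_B:
  "c \<in> D \<Longrightarrow> d \<in> D \<Longrightarrow> d' \<in> D \<Longrightarrow> rel_int B (num 8) [c, d, d'] \<Longrightarrow> v \<in> D \<Longrightarrow> a \<in> D \<Longrightarrow>
     sat_B v c a \<longleftrightarrow> sat_B v d a \<and> sat_B v d' a"
  using B_axioms(17) by (simp add: ax_sat_conj_def)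

lemma sat_ex_B:
  "c \<in> D \<Longrightarrow> n \<in> D \<Longrightarrow> d \<in> D \<Longrightarrow> rel_int B (num 9) [c, n, d] \<Longrightarrow> v \<in> D \<Longrightarrow> a \<in> D \<Longrightarrow>
     sat_B v c a \<longleftrightarrow> (\<exists>x\<in>D. mem_B x v \<and> sat_B v d (upd_B a n x))"
  using B_axioms(18) by (simp add: ax_sat_ex_def)

section \<open>Well-foundedness and collapse of the extension\<close>

definition rel_B :: "('v \<times> 'v) set" where
  "rel_B = {(y, x). y \<in> D \<and> x \<in> D \<and> mem_B y x}"

text \<open>An infinite descending chain of \<open>rel_B\<close> would yield a descending chain of cardinalities.\<close>

lemma wf_rel_B: "wf rel_B"
proof (rule wf_subset)
  let ?f = "\<lambda>x. card_of {z \<in> D. rank_B z x}"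
  show "wf (inv_image ordLess ?f)" by (intro wf_inv_image wf_ordLess)
  show "rel_B \<subseteq> inv_image ordLess ?f"
  proof
    fix p assume "p \<in> rel_B"
    then obtain y x where p: "p = (y, x)" "y \<in> D" "x \<in> D" "mem_B y x" by (auto simp: rel_B_def)
    \<comment> \<open>Inclusion gives the weak inequality of cardinals; the Haertig axiom then
      excludes equality.\<close>
    have "(?f y, ?f x) \<in> ordLeq" using rank_subset_B p by (intro card_of_mono1) auto
    moreover have "(?f y, ?f x) \<notin> ordIso"
      using rank_size_B p by (simp add: eqpoll_iff_card_of_ordIso)
    ultimately show "p \<in> inv_image ordLess ?f"
      using p(1) ordLeq_iff_ordLess_or_ordIso by (auto simp: in_inv_image)
  qed
qed

definition \<pi> :: "'v \<Rightarrow> 'v" where "\<pi> = collapse rel_B"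

lemma elts_\<pi>: "x \<in> D \<Longrightarrow> elts (\<pi> x) = \<pi> ` {y \<in> D. mem_B y x}"
proof -
  assume x: "x \<in> D"
  have "small {y. (y, x) \<in> rel_B}" by (rule small_subset[OF small_D]) (auto simp: rel_B_def)
  from elts_collapse[OF wf_rel_B this] show ?thesis using x by (simp add: \<pi>_def rel_B_def)
qed

text \<open>Well-founded induction on \<open>x\<close>: equal collapses have the same collapsed
  elements, hence the same elements, and \<open>ax_ext\<close> applies.\<close>

lemma inj_\<pi>: "inj_on \<pi> D"
proof -
  have "\<forall>y\<in>D. x \<in> D \<longrightarrow> \<pi> x = \<pi> y \<longrightarrow> x = y" for x
    using wf_rel_B
  proof (induction x rule: wf_induct_rule)
    case (less x)
    show ?case
    proof (intro ballI impI)
      fix y assume y: "y \<in> D" and x: "x \<in> D" and eq: "\<pi> x = \<pi> y"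
      have img: "\<pi> ` {z \<in> D. mem_B z x} = \<pi> ` {z \<in> D. mem_B z y}"
        using arg_cong[OF eq, of elts] elts_\<pi>[OF x] elts_\<pi>[OF y] by simp
      have IH: "z = w" if "z \<in> D" "mem_B z x" "w \<in> D" "\<pi> z = \<pi> w" for z w
        using less[of z] that x unfolding rel_B_def by blast
      have "mem_B z x \<longleftrightarrow> mem_B z y" if z: "z \<in> D" for z
      proof
        assume zx: "mem_B z x"
        then have "\<pi> z \<in> \<pi> ` {z \<in> D. mem_B z y}" unfolding img[symmetric] using z by blast
        then obtain w where "w \<in> D" "mem_B w y" "\<pi> z = \<pi> w" by auto
        then show "mem_B z y" using IH[OF z zx] by simp
      next
        assume "mem_B z y"
        then have "\<pi> z \<in> \<pi> ` {z \<in> D. mem_B z x}" unfolding img using z by blast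
        then obtain w where "w \<in> D" "mem_B w x" "\<pi> w = \<pi> z" by auto
        then show "mem_B z x" using IH[of w z] z by simp
      qed
      then show "x = y" using ext_B x y by blast
    qed
  qed
  then show ?thesis by (intro inj_onI) blast
qed

lemma \<pi>_eq_iff: "x \<in> D \<Longrightarrow> y \<in> D \<Longrightarrow> \<pi> x = \<pi> y \<longleftrightarrow> x = y"
  using inj_\<pi> by (auto dest: inj_onD)

lemma \<pi>_mem_iff: "x \<in> D \<Longrightarrow> y \<in> D \<Longrightarrow> \<pi> x \<in> elts (\<pi> y) \<longleftrightarrow> mem_B x y"
  using elts_\<pi>[of y] \<pi>_eq_iff by auto

lemma mem_B_iff: "x \<in> V_stage \<theta> \<Longrightarrow> y \<in> V_stage \<theta> \<Longrightarrow> mem_B x y \<longleftrightarrow> x \<in> elts y"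
  using rel_B_iff[of 0 "[x, y]"] by simp

text \<open>Induction along \<open>rel_B\<close>, with \<open>ax_rank\<close> providing the step of
  the stage recursion.\<close>

lemma \<pi>_in_V_stage: "x \<in> D \<Longrightarrow> z \<in> D \<Longrightarrow> rank_B z x \<Longrightarrow> \<pi> z \<in> V_stage (\<pi> x)"
  using wf_rel_B
proof (induction x arbitrary: z rule: wf_induct_rule)
  case (less x)
  then obtain y where y: "y \<in> D" "mem_B y x" "\<forall>w\<in>D. mem_B w z \<longrightarrow> rank_B w y"
    using rank_B by blast
  then have "elts (\<pi> z) \<subseteq> V_stage (\<pi> y)"
    using less.IH[of y] less.prems elts_\<pi>[of z] by (auto simp: rel_B_def)
  then show ?case using y less.prems \<pi>_mem_iff V_stage_iff by blast
qed

section \<open>The tower in the extension\<close>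

lemma tower_B_t: "tower_B (t n)"
  using rel_B_iff[of 2 "[t n]"] t_in_V by simp

text \<open>By well-founded induction, a member is the base or the successor of an old member; on
  old elements the functions of \<open>B\<close> are the original ones.\<close>

lemma tower_B_imp_t: "x \<in> D \<Longrightarrow> tower_B x \<Longrightarrow> x \<in> range t"
  using wf_rel_B
proof (induction x rule: wf_induct_rule)
  case (less x)
  from tower_B_cases[OF less.prems] show ?case
  proof
    assume "x = fun_int B (num 5) []"
    then show ?thesis using fun_B_eq[of 5 "[]"] by simp
  next
    assume "\<exists>y\<in>D. mem_B y x \<and> tower_B y \<and> x = fun_int B (num 2) [y]"
    then obtain y where y: "y \<in> D" "mem_B y x" "tower_B y" "x = fun_int B (num 2) [y]" by blast
    then obtain n where n: "y = t n" using less by (auto simp: rel_B_def)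
    then have "x = t (Suc n)" using y(4) fun_B_eq[of 2 "[t n]"] t_in_V by simp
    then show ?thesis by blast
  qed
qed

lemma Ord_\<pi>_t: "Ord (\<pi> (t n))"
proof -
  have t: "t n \<in> D" using t_in_V V_subset_D by blast
  have "elts (\<pi> y) \<subseteq> elts (\<pi> (t n))" if "y \<in> D" "mem_B y (t n)" for y
    using tower_trans_B[OF t tower_B_t that] elts_\<pi>[OF t] elts_\<pi>[OF that(1)] by blast
  moreover have "elts (\<pi> z) \<subseteq> elts (\<pi> y)" if "y \<in> D" "mem_B y (t n)" "z \<in> D" "mem_B z y" for y z
    using tower_elem_trans_B[OF t tower_B_t that] elts_\<pi>[OF that(1)] elts_\<pi>[OF that(3)] by blast
  ultimately show ?thesis
    unfolding Ord_iff using elts_\<pi>[OF t] elts_\<pi> by auto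
qed

text \<open>Otherwise every \<open>\<pi> (t n)\<close> is below \<open>\<theta>\<close>. Cofinality
  of the tower then puts the whole collapse inside \<open>V_stage \<theta>\<close>, against the size
  of \<open>B\<close>.\<close>

lemma ex_pushed_up: "\<exists>n. elts \<theta> \<subseteq> elts (\<pi> (t n))"
proof (rule ccontr)
  assume *: "\<nexists>n. elts \<theta> \<subseteq> elts (\<pi> (t n))"
  have "V_stage (\<pi> (t n)) \<subseteq> V_stage \<theta>" for n
  proof -
    have "\<pi> (t n) \<in> elts \<theta>"
      using Ord_\<pi>_t[of n] Ord_\<theta>
    proof (cases rule: Ord_linear)
      case 2
      then have "elts \<theta> \<subseteq> elts (\<pi> (t n))" by simp
      then show ?thesis using * by blast
    next
      case 3
      then have "elts \<theta> \<subseteq> elts (\<pi> (t n))" using Ord_trans[OF Ord_\<pi>_t[of n] 3] by blast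
      then show ?thesis using * by blast
    qed
    then show ?thesis by (rule V_stage_lesspoll(1))
  qed
  moreover have "\<exists>n. \<pi> x \<in> V_stage (\<pi> (t n))" if "x \<in> D" for x
    using cofinal_B[OF that] tower_B_imp_t \<pi>_in_V_stage that by (metis rangeE)
  ultimately have "\<pi> ` D \<subseteq> V_stage \<theta>" by blast
  then have "D \<lesssim> V_stage \<theta>" using inj_\<pi> by (auto simp: lepoll_def)
  then show False using B_large by blast
qed

text \<open>If \<open>size_of \<kappa>\<close> were below \<open>\<kappa>\<close>, it would be fixed
  together with its elements. Each element of \<open>\<pi> \<kappa>\<close> would then come from an
  old value of the enumeration, so \<open>\<pi> \<kappa>\<close> could have no new elements.\<close>

lemma Card_critical:
  assumes \<kappa>: "Ord \<kappa>" "\<kappa> \<in> elts \<theta>" "\<pi> \<kappa> \<noteq> \<kappa>" and fixed: "\<And>\<xi>. \<xi> \<in> elts \<kappa> \<Longrightarrow> \<pi> \<xi> = \<xi>"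
  shows "Card \<kappa>"
proof (rule ccontr)
  assume "\<not> Card \<kappa>"
  then have b: "size_of \<kappa> \<in> elts \<kappa>" using \<kappa>(1) size_of_in by blast
  have \<kappa>V: "\<kappa> \<in> V_stage \<theta>" using \<kappa>(2) \<theta>_subset_V by blast
  have eV: "\<xi> \<in> V_stage \<theta>" if "\<xi> \<in> elts \<kappa>" for \<xi> using that \<kappa>V elts_in_V by blast
  have \<kappa>D: "\<kappa> \<in> D" using \<kappa>V V_subset_D by blast
  have "elts (\<pi> \<kappa>) = elts \<kappa>"
  proof
    show "elts \<kappa> \<subseteq> elts (\<pi> \<kappa>)"
    proof
      fix \<xi> assume \<xi>: "\<xi> \<in> elts \<kappa>"
      then have "\<pi> \<xi> \<in> elts (\<pi> \<kappa>)" using \<pi>_mem_iff \<kappa>D mem_B_iff \<kappa>V eV V_subset_D by blast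
      then show "\<xi> \<in> elts (\<pi> \<kappa>)" using fixed[OF \<xi>] by simp
    qed
    show "elts (\<pi> \<kappa>) \<subseteq> elts \<kappa>"
    proof
      fix u assume "u \<in> elts (\<pi> \<kappa>)"
      then obtain y where y: "u = \<pi> y" "y \<in> D" "mem_B y \<kappa>" using elts_\<pi>[OF \<kappa>D] by blast
      then obtain z where z: "z \<in> D" "mem_B z (fun_int B (num 3) [\<kappa>])" "y = fun_int B (num 4) [\<kappa>, z]"
        using enum_B[OF \<kappa>D] by blast
      have "fun_int B (num 3) [\<kappa>] = size_of \<kappa>" using fun_B_eq[of 3 "[\<kappa>]"] \<kappa>V by simp
      then have "\<pi> z \<in> elts (\<pi> (size_of \<kappa>))"
        using z \<pi>_mem_iff eV[OF b] V_subset_D by auto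
      then have zb: "\<pi> z \<in> elts (size_of \<kappa>)" using fixed[OF b] by simp
      then have zk: "\<pi> z \<in> elts \<kappa>" using Ord_trans[OF \<kappa>(1) b] by blast
      \<comment> \<open>The set \<open>\<pi> z\<close> is itself an element of the domain and fixed,
        so \<open>z\<close> and \<open>\<pi> z\<close> have the same collapse.\<close>
      then have "z = \<pi> z"
        using \<pi>_eq_iff[of "\<pi> z" z] fixed[OF zk] eV[OF zk] V_subset_D z(1) by auto
      then have "y = enumeration \<kappa> (\<pi> z)"
        using z(3) fun_B_eq[of 4 "[\<kappa>, \<pi> z]"] \<kappa>V eV[OF zk] by simp
      then have "y \<in> elts \<kappa>" using bij_enumeration[of \<kappa>] zb by (auto simp: bij_betw_def)
      then show "u \<in> elts \<kappa>" using fixed y(1) by simp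
    qed
  qed
  then show False using \<kappa>(3) by simp
qed

section \<open>Satisfaction and embeddings of the stages\<close>

lemma get_B_in_D: "a \<in> D \<Longrightarrow> n \<in> D \<Longrightarrow> get_B a n \<in> D"
  using fun_B_in_D[of 0 "[a, n]"] by simp

lemma upd_B_in_D: "a \<in> D \<Longrightarrow> n \<in> D \<Longrightarrow> x \<in> D \<Longrightarrow> upd_B a n x \<in> D"
  using fun_B_in_D[of 1 "[a, n, x]"] by simp

lemma num_in_D: "num i \<in> D"
  using num_in_V V_subset_D by blast

lemma code_in_D: "code \<psi> \<in> D"
  using code_in_V V_subset_D by blast

lemma get_upd_B:
  "a \<in> D \<Longrightarrow> x \<in> D \<Longrightarrow>
     (\<lambda>i. \<pi> (get_B (upd_B a (num n) x) (num i))) = (\<lambda>i. \<pi> (get_B a (num i)))(n := \<pi> x)"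
  using get_upd_same_B get_upd_other_B num_in_D by (auto simp: fun_eq_iff)

text \<open>Induction on the formula by Tarski's clauses. The assignment \<open>a\<close> stays
  arbitrary in \<open>D\<close>, because the existential clause updates it with new
  elements.\<close>

lemma sat_B_iff:
  assumes "fm_of set_lang \<psi>" "first_order \<psi>" "v \<in> D" "a \<in> D"
  shows "sat_B v (code \<psi>) a \<longleftrightarrow> sat (mem_struct (elts (\<pi> v))) (\<lambda>i. \<pi> (get_B a (num i))) \<psi>"
  using assms
proof (induction \<psi> arbitrary: a)
  case (Eq s u)
  have "trm_of set_lang s" "trm_of set_lang u" using Eq.prems(1) by auto
  then obtain i j where ij: "s = Var i" "u = Var j" using trm_of_set_lang by blast
  have "rel_int B (num 5) [code (Eq (Var i) (Var j)), num i, num j]"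
    using rel_B_iff[of 5 "[code (Eq (Var i) (Var j)), num i, num j]"] code_in_V num_in_V by simp
  then show ?case
    using sat_eq_B[OF code_in_D num_in_D num_in_D] Eq.prems ij \<pi>_eq_iff get_B_in_D num_in_D by simp
next
  case (Rel r ts)
  \<comment> \<open>The only relation symbol is binary and all terms are variables, so the atom is a
    membership formula.\<close>
  obtain x y where xy: "ts = [x, y]"
    using Rel.prems(1) by (auto simp: set_lang_def length_Suc_conv numeral_2_eq_2)
  then have "trm_of set_lang x" "trm_of set_lang y" using Rel.prems(1) by auto
  then obtain i j where "x = Var i" "y = Var j" using trm_of_set_lang by blast
  then have ij: "Rel r ts = mem_f i j" using xy by (simp add: mem_f_def)
  have "rel_int B (num 6) [code (mem_f i j), num i, num j]"
    using rel_B_iff[of 6 "[code (mem_f i j), num i, num j]"] code_in_V num_in_V by auto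
  then show ?case
    unfolding ij sat_mem_f mem_iff_elts
    using sat_mem_B[OF code_in_D num_in_D num_in_D] Rel.prems \<pi>_mem_iff get_B_in_D num_in_D by simp
next
  case (Neg \<psi>)
  have "rel_int B (num 7) [code (Neg \<psi>), code \<psi>]"
    using rel_B_iff[of 7 "[code (Neg \<psi>), code \<psi>]"] code_in_V by simp
  then show ?case using sat_neg_B[OF code_in_D code_in_D] Neg by simp
next
  case (Conj \<psi> \<chi>)
  have "rel_int B (num 8) [code (Conj \<psi> \<chi>), code \<psi>, code \<chi>]"
    using rel_B_iff[of 8 "[code (Conj \<psi> \<chi>), code \<psi>, code \<chi>]"] code_in_V by simp
  then show ?case using sat_conj_B[OF code_in_D code_in_D code_in_D] Conj by simp
next
  case (Ex n \<psi>)
  have "rel_int B (num 9) [code (Ex n \<psi>), num n, code \<psi>]"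
    using rel_B_iff[of 9 "[code (Ex n \<psi>), num n, code \<psi>]"] code_in_V num_in_V by simp
  then have "sat_B v (code (Ex n \<psi>)) a \<longleftrightarrow>
      (\<exists>x\<in>D. mem_B x v \<and> sat_B v (code \<psi>) (upd_B a (num n) x))"
    using sat_ex_B[OF code_in_D num_in_D code_in_D] Ex.prems by blast
  also have "\<dots> \<longleftrightarrow> (\<exists>x\<in>D. mem_B x v \<and>
      sat (mem_struct (elts (\<pi> v))) ((\<lambda>i. \<pi> (get_B a (num i)))(n := \<pi> x)) \<psi>)"
    using Ex.IH Ex.prems upd_B_in_D num_in_D get_upd_B by (intro bex_cong refl conj_cong) simp_all
  also have "\<dots> \<longleftrightarrow> sat (mem_struct (elts (\<pi> v))) (\<lambda>i. \<pi> (get_B a (num i))) (Ex n \<psi>)"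
    using elts_\<pi>[OF Ex.prems(3)] by auto
  finally show ?case .
qed simp

lemma stage_embedding:
  assumes \<alpha>: "\<alpha> \<in> elts \<theta>" "omega \<in> elts \<alpha>" and v: "elts v = V_stage \<alpha>"
  shows "transitive_class (elts (\<pi> v))" "cardinal_correct (elts (\<pi> v))"
    "elementary_embedding set_lang (mem_struct (V_stage \<alpha>)) (mem_struct (elts (\<pi> v))) \<pi>"
proof -
  have "set_of (V_stage \<alpha>) \<in> V_stage \<theta>" using \<alpha>(1) by (intro set_of_in_V_stage[of _ \<alpha>]) auto
  then have vV: "v \<in> V_stage \<theta>" using v by (metis set_of_elts)
  then have vD: "v \<in> D" using V_subset_D by blast
  have st: "stage_B v" using rel_B_iff[of 3 "[v]"] vV \<alpha> v by (auto simp: is_stage_def)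
  show tr: "transitive_class (elts (\<pi> v))"
    unfolding transitive_class_def
  proof (intro ballI subsetI)
    fix x y assume "x \<in> elts (\<pi> v)" "y \<in> elts x"
    then obtain x' y' where "x' \<in> D" "mem_B x' v" "y' \<in> D" "mem_B y' x'" "y = \<pi> y'"
      using elts_\<pi>[OF vD] elts_\<pi> by auto
    then show "y \<in> elts (\<pi> v)" using stage_trans_B[OF vD st] elts_\<pi>[OF vD] by blast
  qed
  show "cardinal_correct (elts (\<pi> v))"
    unfolding cardinal_correct_def
  proof (intro ballI impI)
    fix u assume u: "u \<in> elts (\<pi> v)" "card_in (elts (\<pi> v)) u"
    then obtain x where x: "x \<in> D" "mem_B x v" "u = \<pi> x" using elts_\<pi>[OF vD] by blast
    \<comment> \<open>Any element of \<open>D\<close> can serve as the assignment to be updated;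
      \<open>v\<close> is at hand.\<close>
    have "sat (mem_struct (elts (\<pi> v))) (\<lambda>i. \<pi> (get_B (upd_B v (num 0) x) (num i))) (card_f 0 1)"
      using u(2) x(3) get_upd_B[OF vD x(1)] by (simp add: sat_card_f)
    then have "sat_B v (code (card_f 0 1)) (upd_B v (num 0) x)"
      using sat_B_iff card_f_set_lang vD upd_B_in_D num_in_D x(1) by blast
    then have s: "sat_B v (fun_int B (num 6) []) (upd_B v (fun_int B (num 7) []) x)"
      using fun_B_eq[of 6 "[]"] fun_B_eq[of 7 "[]"] by simp
    have "Ord u" using u ord_in_iff[OF tr] by (auto simp: card_in_def)
    moreover have "\<not> elts \<beta> \<approx> elts u" if \<beta>: "\<beta> \<in> elts u" for \<beta>
    proof -
      obtain y where y: "y \<in> D" "mem_B y x" "\<beta> = \<pi> y" using \<beta> elts_\<pi>[OF x(1)] x(3) by blast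
      \<comment> \<open>Injectivity of the collapse turns equipollence inside \<open>B\<close>, as
        seen by the Haertig quantifier, into equipollence of true sets.\<close>
      have "elts (\<pi> w) \<approx> {z \<in> D. mem_B z w}" if "w \<in> D" for w
        unfolding elts_\<pi>[OF that]
        by (rule inj_on_image_eqpoll_self) (rule inj_on_subset[OF inj_\<pi>], auto)
      then show ?thesis
        using stage_card_B[OF vD st x(1,2) vD s y(1,2)] x y by (meson eqpoll_sym eqpoll_trans)
    qed
    ultimately show "Card u" by (simp add: Card_def)
  qed
  show "elementary_embedding set_lang (mem_struct (V_stage \<alpha>)) (mem_struct (elts (\<pi> v))) \<pi>"
    unfolding elementary_embedding_def Dom_mem_struct
  proof (intro conjI allI impI subsetI)
    fix u assume "u \<in> \<pi> ` V_stage \<alpha>"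
    then obtain x where "u = \<pi> x" "x \<in> elts v" using v by blast
    then show "u \<in> elts (\<pi> v)"
      using \<pi>_mem_iff mem_B_iff vV vD elts_in_V V_subset_D by blast
  next
    fix \<psi> :: "unit fm" and e :: "nat \<Rightarrow> 'v" assume \<psi>: "fm_of set_lang \<psi> \<and> first_order \<psi> \<and> range e \<subseteq> V_stage \<alpha>"
    \<comment> \<open>The assignment becomes a set, to be an argument of \<open>Sat\<close>. All its
      values lie below a single level of the tower, so the set is in
      \<open>V_stage \<theta>\<close>.\<close>
    define a where "a = set_of (range (\<lambda>i. kpair (num i) (e i)))"
    have elts_a: "elts a = range (\<lambda>i. kpair (num i) (e i))" by (simp add: a_def)
    obtain m where m: "\<alpha> \<in> elts (t m)" using \<alpha>(1) elts_\<theta> by blast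
    have "e i \<in> V_stage (t m)" for i using \<psi> V_stage_lesspoll(1)[OF m] by blast
    then have "range (\<lambda>i. kpair (num i) (e i)) \<subseteq> V_stage (t (Suc (Suc m)))"
      using kpair_in_V_t num_in_V_t by blast
    then have aV: "a \<in> V_stage \<theta>" unfolding a_def using set_of_V_t V_t_subset by blast
    then have aD: "a \<in> D" using V_subset_D by blast
    have get: "get a (num i) = e i" for i by (rule get_eqI) (auto simp: elts_a)
    have get': "get_B a (num i) = e i" for i
      using fun_B_eq[of 0 "[a, num i]"] aV num_in_V get by simp
    \<comment> \<open>Truth in the stage is recorded by \<open>Sat\<close>, inherited by
      \<open>sat_B\<close> through the substructure, and read off in the collapse.\<close>
    have "sat (mem_struct (V_stage \<alpha>)) e \<psi> \<longleftrightarrow> Sat v (code \<psi>) a"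
      by (simp add: Sat_code v get)
    also have "\<dots> \<longleftrightarrow> sat_B v (code \<psi>) a"
      using rel_B_iff[of 4 "[v, code \<psi>, a]"] vV aV code_in_V by simp
    also have "\<dots> \<longleftrightarrow> sat (mem_struct (elts (\<pi> v))) (\<pi> \<circ> e) \<psi>"
      using sat_B_iff[of \<psi> v a] \<psi> vD aD by (simp add: get' comp_def)
    finally show "sat (mem_struct (V_stage \<alpha>)) e \<psi> \<longleftrightarrow> sat (mem_struct (elts (\<pi> v))) (\<pi> \<circ> e) \<psi>" .
  qed
qed

text \<open>The single map \<open>\<pi>\<close> yields the embeddings for all
  \<open>\<alpha>\<close> at once, so \<open>n\<close> and \<open>\<kappa>\<close> do not depend on
  \<open>\<alpha>\<close>. The critical point is the least ordinal below \<open>\<theta>\<close>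
  that is moved.\<close>

lemma ex_critical_embedding:
  "\<exists>n \<kappa>. Card \<kappa> \<and> \<kappa> \<^bold>\<le> t n \<and> (\<forall>\<alpha>\<in>elts \<theta>. t n \<in> elts \<alpha> \<longrightarrow>
     (\<exists>M j. small M \<and> transitive_class M \<and> cardinal_correct M \<and>
        elementary_embedding set_lang (mem_struct (V_stage \<alpha>)) (mem_struct M) j \<and>
        critical_point (V_stage \<alpha>) j \<kappa> \<and> \<alpha> \<^bold>\<in> j (t n)))"
proof -
  obtain n where n: "elts \<theta> \<subseteq> elts (\<pi> (t n))" using ex_pushed_up by blast
  \<comment> \<open>As an element of \<open>\<theta>\<close>, \<open>t n\<close> is an element of
    its own image.\<close>
  then have "\<pi> (t n) \<noteq> t n" using t_in_\<theta>[of n] by (metis mem_not_refl subsetD)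
  then have "t n \<in> elts \<theta> \<and> \<pi> (t n) \<noteq> t n" using t_in_\<theta> by blast
  from ex_mem_minimal[of "\<lambda>x. x \<in> elts \<theta> \<and> \<pi> x \<noteq> x", OF this]
  obtain \<kappa> where \<kappa>: "\<kappa> \<in> elts \<theta>" "\<pi> \<kappa> \<noteq> \<kappa>"
      and min: "\<And>\<xi>. \<xi> \<in> elts \<kappa> \<Longrightarrow> \<not> (\<xi> \<in> elts \<theta> \<and> \<pi> \<xi> \<noteq> \<xi>)" by blast
  have fixed: "\<pi> \<xi> = \<xi>" if "\<xi> \<in> elts \<kappa>" for \<xi>
    using min[OF that] Ord_trans[OF Ord_\<theta> \<kappa>(1) that] by blast
  have o: "Ord \<kappa>" using Ord_in_Ord[OF Ord_\<theta> \<kappa>(1)] .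
  have le: "\<kappa> \<^bold>\<le> t n"
    using o Ord_t[of n]
  proof (cases rule: Ord_linear)
    case 3
    then show ?thesis using fixed \<open>\<pi> (t n) \<noteq> t n\<close> by blast
  qed (auto simp: ord_le_def mem_iff_elts)
  have "\<exists>M j. small M \<and> transitive_class M \<and> cardinal_correct M \<and>
        elementary_embedding set_lang (mem_struct (V_stage \<alpha>)) (mem_struct M) j \<and>
        critical_point (V_stage \<alpha>) j \<kappa> \<and> \<alpha> \<^bold>\<in> j (t n)"
    if \<alpha>: "\<alpha> \<in> elts \<theta>" "t n \<in> elts \<alpha>" for \<alpha>
  proof -
    have oa: "Ord \<alpha>" using Ord_in_Ord[OF Ord_\<theta> \<alpha>(1)] .
    have om: "omega \<in> elts \<alpha>" using Ord_trans[OF oa \<alpha>(2) omega_in_t] .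
    have "\<kappa> \<in> elts \<alpha>" using le \<alpha>(2) Ord_trans[OF oa \<alpha>(2)] by (auto simp: ord_le_def mem_iff_elts)
    then have "critical_point (V_stage \<alpha>) \<pi> \<kappa>"
      using o \<kappa>(2) fixed elts_subset_V_stage by (auto simp: critical_point_def)
    moreover have "\<alpha> \<^bold>\<in> \<pi> (t n)" using n \<alpha>(1) by (auto simp: mem_iff_elts)
    ultimately show ?thesis
      using stage_embedding[OF \<alpha>(1) om elts_set_of[OF small_V_stage]] small_elts by blast
  qed
  then show ?thesis using Card_critical[OF o \<kappa> fixed] le by blast
qed

end

section \<open>Building the tower and deriving the contradiction\<close>

theorem theorem11p2:
  assumes "\<exists>\<delta>::'v::zfc. is_ULST \<delta>"
  shows "\<exists>\<kappa> \<gamma> :: 'v. Card \<kappa> \<and> Card \<gamma> \<and> \<kappa> \<^bold>\<le> \<gamma> \<and> cc_extendible_pushing_up \<kappa> \<gamma>"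
proof (rule ccontr)
  assume no: "\<not> ?thesis"
  define good where "good = (\<lambda>\<kappa> \<gamma> \<alpha> :: 'v. \<exists>M j. small M \<and> transitive_class M \<and> cardinal_correct M \<and>
      elementary_embedding set_lang (mem_struct (V_stage \<alpha>)) (mem_struct M) j \<and>
      critical_point (V_stage \<alpha>) j \<kappa> \<and> \<alpha> \<^bold>\<in> j \<gamma>)"
  have "\<exists>\<alpha>. Card \<kappa> \<and> Card \<gamma> \<and> \<kappa> \<^bold>\<le> \<gamma> \<longrightarrow> Ord \<alpha> \<and> \<gamma> \<in> elts \<alpha> \<and> \<not> good \<kappa> \<gamma> \<alpha>" for \<kappa> \<gamma>
    using no unfolding cc_extendible_pushing_up_def good_def mem_iff_elts by blast
  then obtain bad where bad: "\<And>\<kappa> \<gamma>. Card \<kappa> \<Longrightarrow> Card \<gamma> \<Longrightarrow> \<kappa> \<^bold>\<le> \<gamma> \<Longrightarrow>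
      Ord (bad \<kappa> \<gamma>) \<and> \<gamma> \<in> elts (bad \<kappa> \<gamma>) \<and> \<not> good \<kappa> \<gamma> (bad \<kappa> \<gamma>)"
    by metis
  obtain \<delta> :: 'v where \<delta>: "Card \<delta>" "ULST_property \<delta>" using assms by (auto simp: is_ULST_def)
  \<comment> \<open>Starting above \<open>\<delta>\<close> makes \<open>V_stage \<theta>\<close>
    large enough for the ULST property.\<close>
  have "Ord x" if "x \<in> {\<delta>, omega}" for x using that \<delta>(1) by (auto simp: Card_def)
  then obtain t0 where t0: "Card t0" "\<delta> \<in> elts t0" "omega \<in> elts t0"
    using ex_Card_above[of "{\<delta>, omega}"] by auto
  have "\<exists>\<gamma>'. Card \<gamma> \<longrightarrow> Card \<gamma>' \<and> \<gamma> \<in> elts \<gamma>' \<and>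
      (\<forall>\<kappa>. Card \<kappa> \<longrightarrow> \<kappa> \<^bold>\<le> \<gamma> \<longrightarrow> bad \<kappa> \<gamma> \<in> elts \<gamma>')" for \<gamma>
  proof (cases "Card \<gamma>")
    case True
    \<comment> \<open>The cardinals up to \<open>\<gamma>\<close> are elements of
      \<open>suc \<gamma>\<close>, so the ordinals to be exceeded form a small class.\<close>
    let ?X = "insert \<gamma> ((\<lambda>\<kappa>. bad \<kappa> \<gamma>) ` {\<kappa> \<in> elts (suc \<gamma>). Card \<kappa>})"
    have "small ?X"
      by (intro small_insert small_image small_subset[OF small_elts[of "suc \<gamma>"]]) auto
    moreover have "Ord x" if "x \<in> ?X" for x
      using that True bad by (auto simp: Card_def ord_le_def mem_iff_elts)
    ultimately obtain \<gamma>' where "Card \<gamma>'" "?X \<subseteq> elts \<gamma>'" using ex_Card_above by blast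
    then show ?thesis by (intro exI[of _ \<gamma>']) (auto simp: ord_le_def mem_iff_elts)
  qed simp
  then obtain up where up: "\<And>\<gamma>. Card \<gamma> \<Longrightarrow> Card (up \<gamma>) \<and> \<gamma> \<in> elts (up \<gamma>) \<and>
      (\<forall>\<kappa>. Card \<kappa> \<longrightarrow> \<kappa> \<^bold>\<le> \<gamma> \<longrightarrow> bad \<kappa> \<gamma> \<in> elts (up \<gamma>))"
    by metis
  define t where "t = (\<lambda>n. (up ^^ n) t0)"
  have Card_t: "Card (t n)" for n by (induction n) (use t0 up in \<open>auto simp: t_def\<close>)
  have t_up: "t (Suc n) = up (t n)" for n by (simp add: t_def)
  interpret tower t
    by unfold_locales (use Card_t t_up up t0 in \<open>auto simp: t_def\<close>)
  \<comment> \<open>The ULST property is applied at the size of \<open>V_stage \<theta>\<close>,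
    with any larger cardinal as the target.\<close>
  obtain \<gamma> :: 'v where \<gamma>: "Card \<gamma>" "elts \<gamma> \<approx> V_stage \<theta>" using ex_Card_eqpoll small_V_stage by blast
  obtain \<gamma>' :: 'v where \<gamma>': "Card \<gamma>'" "\<gamma> \<in> elts \<gamma>'"
    using up[OF \<gamma>(1)] by blast
  have "\<delta> \<in> elts (t 0)" using t0(2) by (simp add: t_def)
  then have "\<delta> \<in> V_stage \<theta>" using elts_\<theta> \<theta>_subset_V by blast
  then have "elts \<delta> \<subseteq> V_stage \<theta>" using V_stage_trans by blast
  then have "elts \<delta> \<lesssim> elts \<gamma>"
    using \<gamma>(2) by (meson eqpoll_sym lepoll_trans2 subset_imp_lepoll)
  then have "\<delta> \<^bold>\<le> \<gamma>" using Card_le_Card \<delta>(1) \<gamma>(1) by blast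
  moreover have "small (Funs tower_lang)" "small (Rels tower_lang)"
    by (auto simp: tower_lang_def intro: small_subset[OF small_range_num])
  ultimately obtain B where B: "structure_of tower_lang B" "B \<Turnstile> tower_sentence"
      "elts \<gamma>' \<lesssim> Dom B" "substructure tower_lang tower_struct B"
    using \<delta>(2) \<gamma> \<gamma>' sentence_of_tower_sentence structure_of_tower_struct tower_struct_models
    unfolding ULST_property_def mem_iff_elts by (metis eqpoll_sym tower_struct_simps(1))
  have "\<not> Dom B \<lesssim> V_stage \<theta>"
  proof
    assume "Dom B \<lesssim> V_stage \<theta>"
    then have "elts \<gamma>' \<lesssim> elts \<gamma>" using B(3) \<gamma>(2) by (meson eqpoll_sym lepoll_trans lepoll_trans2)
    then have "\<gamma>' \<^bold>\<le> \<gamma>" using Card_le_Card \<gamma>(1) \<gamma>'(1) by blast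
    then show False using \<gamma>'(2) mem_asym by (auto simp: ord_le_def mem_iff_elts)
  qed
  then interpret tower_extension t B by unfold_locales (use B in auto)
  obtain n \<kappa> where \<kappa>: "Card \<kappa>" "\<kappa> \<^bold>\<le> t n" "\<And>\<alpha>. \<alpha> \<in> elts \<theta> \<Longrightarrow> t n \<in> elts \<alpha> \<Longrightarrow> good \<kappa> (t n) \<alpha>"
    using ex_critical_embedding unfolding good_def by blast
  \<comment> \<open>The choice of \<open>up\<close> puts the failing ordinal below
    \<open>\<theta>\<close>, within the reach of the embeddings.\<close>
  have "bad \<kappa> (t n) \<in> elts (t (Suc n))" using up[OF Card_t] \<kappa>(1,2) t_up by simp
  then have "bad \<kappa> (t n) \<in> elts \<theta>" using elts_\<theta> by blast
  then show False using bad[OF \<kappa>(1) Card_t \<kappa>(2)] \<kappa>(3) by blast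
qed

end
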